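(* Let $n\ge 2$, $0<\lambda\le\Lambda$ and $p,q>0$. The only nonnegative (viscosity) supersolution $(u,v)$ of the system $$\begin{cases}\mathcal M^-_{\lambda,\Lambda}(D^2u)+v^p=0 & \text{in }\mathbb R^n_+,\\ \mathcal M^-_{\lambda,\Lambda}(D^2v)+u^q=0 & \text{in }\mathbb R^n_+\end{cases}$$ (no boundary condition is imposed) is the trivial one, $u\equiv v\equiv0$, if one of the following holds: (1) $pq>1$ and, moreover, $\frac{2(p+1)}{pq-1}>\frac{\Lambda n}{\lambda}-1$ or $\frac{2(q+1)}{pq-1}>\frac{\Lambda n}{\lambda}-1$; (2) $\frac{2(p+1)}{pq-1}=\frac{\Lambda n}{\lambda}-1$ and $\frac{2(q+1)}{pq-1}=\frac{\Lambda n}{\lambda}-1$; (3) $pq=1$.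
   Context: $\mathbb R^n_+=\{x=(x',x_n)\in\mathbb R^{n-1}\times\mathbb R : x_n>0\}$. For $0<\lambda\le\Lambda$ and a real symmetric $n\times n$ matrix $M$ with eigenvalues $e_1,\dots,e_n$, the Pucci minimal operator is $\mathcal M^-_{\lambda,\Lambda}(M)=\lambda\sum_{e_i>0}e_i+\Lambda\sum_{e_i<0}e_i$. Viscosity supersolutions: a nonnegative supersolution of the system is a pair $(u,v)$ of continuous functions $u,v:\mathbb R^n_+\to[0,\infty)$ such that: whenever $x_0\in\mathbb R^n_+$, $\phi\in C^2(\mathbb R^n_+)$ and $u-\phi$ has a local minimum at $x_0$, one has $\mathcal M^-_{\lambda,\Lambda}(D^2\phi(x_0))+v(x_0)^p\le 0$; and whenever $v-\phi$ has a local minimum at $x_0$, one has $\mathcal M^-_{\lambda,\Lambda}(D^2\phi(x_0))+u(x_0)^q\le 0$. *)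

theory Defs
  imports "HOL-Analysis.Analysis" "HOL-Computational_Algebra.Polynomial"
begin

text \<open>The coordinate singled out in the half-space is an arbitrary index \<open>k\<close>.\<close>

definition half_space :: "'n::finite \<Rightarrow> (real^'n) set" where
  "half_space k = {x. x $ k > 0}"

definition charpoly :: "real^'n^'n \<Rightarrow> real poly" where
  "charpoly M = det (\<chi> i j. (if i = j then [:0, 1:] else 0) - [:M $ i $ j:])"

text \<open>A multiset, so that eigenvalues are repeated according to multiplicity.
  For symmetric \<open>M\<close> there are exactly \<open>CARD('n)\<close> of them.\<close>

definition eigenvalues :: "real^'n^'n \<Rightarrow> real multiset" where
  "eigenvalues M = proots (charpoly M)"

definition pucci_minus :: "real \<Rightarrow> real \<Rightarrow> real^'n^'n \<Rightarrow> real" where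
  "pucci_minus l L M =
     l * sum_mset {#e \<in># eigenvalues M. e > 0#} + L * sum_mset {#e \<in># eigenvalues M. e < 0#}"

text \<open>\<open>\<phi>\<close> is twice continuously differentiable on \<open>S\<close>, with gradient \<open>D\<phi>\<close> and Hessian matrix
  \<open>D2\<phi>\<close>. The derivatives are full rather than relative to \<open>S\<close>, so \<open>S\<close> is meant to be open;
  then \<open>D\<phi>\<close> and \<open>D2\<phi>\<close> are uniquely determined on \<open>S\<close>.\<close>

definition C2_on ::
  "(real^'n) set \<Rightarrow> (real^'n \<Rightarrow> real) \<Rightarrow> (real^'n \<Rightarrow> real^'n) \<Rightarrow> (real^'n \<Rightarrow> real^'n^'n) \<Rightarrow> bool" where
  "C2_on S \<phi> D\<phi> D2\<phi> \<longleftrightarrow>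
     (\<forall>x\<in>S. (\<phi> has_derivative (\<lambda>h. D\<phi> x \<bullet> h)) (at x)) \<and>
     (\<forall>x\<in>S. (D\<phi> has_derivative (\<lambda>h. D2\<phi> x *v h)) (at x)) \<and>
     continuous_on S D2\<phi>"

definition local_min_on :: "'a::metric_space set \<Rightarrow> ('a \<Rightarrow> real) \<Rightarrow> 'a \<Rightarrow> bool" where
  "local_min_on S f x0 \<longleftrightarrow> x0 \<in> S \<and> (\<exists>r>0. \<forall>x\<in>S. dist x x0 < r \<longrightarrow> f x0 \<le> f x)"

text \<open>\<open>M\<^sup>-(D\<^sup>2u) + f \<le> 0\<close> on \<open>S\<close> in the viscosity sense.\<close>

definition visc_supersol ::
  "real \<Rightarrow> real \<Rightarrow> (real^'n) set \<Rightarrow> (real^'n \<Rightarrow> real) \<Rightarrow> (real^'n \<Rightarrow> real) \<Rightarrow> bool" where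
  "visc_supersol l L S u f \<longleftrightarrow>
     (\<forall>\<phi> D\<phi> D2\<phi> x0. C2_on S \<phi> D\<phi> D2\<phi> \<longrightarrow> local_min_on S (\<lambda>x. u x - \<phi> x) x0 \<longrightarrow>
        pucci_minus l L (D2\<phi> x0) + f x0 \<le> 0)"

text \<open>Only the values of \<open>u\<close> and \<open>v\<close> on the half-space matter. They are nonnegative there, so
  for \<open>p, q > 0\<close> \<open>powr\<close> is the usual power (in particular \<open>0 powr p = 0\<close>).\<close>

definition nonneg_supersolution ::
  "real \<Rightarrow> real \<Rightarrow> real \<Rightarrow> real \<Rightarrow> 'n::finite \<Rightarrow> (real^'n \<Rightarrow> real) \<Rightarrow> (real^'n \<Rightarrow> real) \<Rightarrow> bool" where
  "nonneg_supersolution l L p q k u v \<longleftrightarrow>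
     continuous_on (half_space k) u \<and> continuous_on (half_space k) v \<and>
     (\<forall>x\<in>half_space k. u x \<ge> 0 \<and> v x \<ge> 0) \<and>
     visc_supersol l L (half_space k) u (\<lambda>x. v x powr p) \<and>
     visc_supersol l L (half_space k) v (\<lambda>x. u x powr q)"

end

theory Submission
  imports Defs "HOL-Real_Asymp.Real_Asymp"
begin

text \<open>
  Write \<open>R = L / l\<close>, \<open>n = CARD('n)\<close> and \<open>\<alpha> = R n - 1\<close>. A supersolution that is not trivial is positive, by a Gaussian
  barrier. Touching \<open>u\<close> from below by a paraboloid at its minimum over a ball of radius \<open>\<rho>\<close> centred at height
  \<open>4 \<rho>\<close>, and using the barrier to compare minima over concentric balls, gives
  \<open>(min v)^p \<le> C (min u) / \<rho>^2\<close> and its mirror image, hence \<open>(min u)^(p q - 1) \<le> C \<rho>^(- 2 (p + 1))\<close>.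
  This is absurd for \<open>p q = 1\<close>. For \<open>p q > 1\<close>, the function \<open>x_k^R |x|^(1 - R (n + 1))\<close> is a subsolution of
  homogeneity \<open>- \<alpha>\<close>, so \<open>min u \<ge> c \<rho>^(- \<alpha>)\<close>, which contradicts the upper bound in case (1). In case (2)
  necessarily \<open>p = q\<close> and the two rates agree; with the lower bound for \<open>v\<close> on the right-hand side, the
  subsolution times \<open>ln |x|\<close>, suitably corrected, can be compared with \<open>u\<close> as well, and the additional factor
  \<open>ln \<rho>\<close> gives the contradiction.
\<close>

subsection \<open>Orthonormal frames and the Pucci operator\<close>

text \<open>The Pucci operator is only superadditive, but lower bounds for it do add up, and every
  barrier is treated through such bounds. The exponents of the homogeneous subsolution come from
  balancing traces: if its Hessian is a nonnegative form minus a nonnegative form \<open>P\<close>,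
  the operator is at least \<open>l\<close> times the trace of the Hessian minus
  \<open>(L - l)\<close> times the trace of \<open>P\<close>, and the exponents and the size of
  \<open>P\<close> are tuned so that this is zero. For \<open>L = l\<close> the function is
  \<open>x_k |x|^(- n)\<close>, a multiple of the Poisson kernel. The threshold arises from
  comparing \<open>\<rho>^(- \<alpha> (p q - 1))\<close> with \<open>\<rho>^(- 2 (p + 1))\<close>.
  At equality with \<open>p = q\<close> one has \<open>\<alpha> p = \<alpha> + 2\<close>: the lower
  bound for the source \<open>v^p\<close> has the same degree as the second derivatives of the
  barrier for \<open>u\<close>, and this resonance produces the logarithm. No boundary values are
  known, so the barriers in the half-space vanish on its flat boundary, where only nonnegativity of
  the solution is used.\<close>

definition frame :: "('n::finite \<Rightarrow> real^'n) \<Rightarrow> bool" where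
  "frame w \<longleftrightarrow> (\<forall>i j. w i \<bullet> w j = (if i = j then 1 else 0))"

lemma frame_inner_self: "frame w \<Longrightarrow> w i \<bullet> w i = 1"
  by (simp add: frame_def)

lemma frame_orthogonal_matrix:
  assumes "frame w"
  shows "orthogonal_matrix (\<chi> i. w i)"
  using assms
  by (auto simp: orthogonal_matrix_orthonormal_rows frame_def row_def norm_eq_1 orthogonal_def)

lemma frame_sum_inner_sq:
  fixes v :: "real^'n"
  assumes "frame w"
  shows "(\<Sum>i\<in>UNIV. (v \<bullet> w i)^2) = v \<bullet> v"
proof -
  have "orthogonal_transformation ((*v) (\<chi> i. w i))"
    using frame_orthogonal_matrix[OF assms]
    by (simp add: orthogonal_transformation_matrix)
  then have "((\<chi> i. w i) *v v) \<bullet> ((\<chi> i. w i) *v v) = v \<bullet> v"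
    by (simp add: orthogonal_transformation_def)
  moreover have "((\<chi> i. w i) *v v) $ i = v \<bullet> w i" for i
    by (simp add: matrix_vector_mult_def inner_vec_def mult.commute)
  ultimately show ?thesis
    by (simp add: inner_vec_def[of "(\<chi> i. w i) *v v"] power2_eq_square)
qed

section \<open>Diagonalisation of symmetric matrices\<close>

text \<open>A Rayleigh quotient argument on the orthogonal complement of \<open>B\<close>, which
  \<open>A\<close> maps into itself because \<open>B\<close> consists of eigenvectors: a maximiser
  on its unit sphere is an eigenvector.\<close>

lemma symmetric_eigenvector_on_complement:
  fixes A :: "real^'n^'n" and B :: "(real^'n) set"
  assumes sym: "transpose A = A"
    and eig: "\<And>b. b \<in> B \<Longrightarrow> \<exists>e. A *v b = e *\<^sub>R b"
    and z: "z \<noteq> 0" "\<And>b. b \<in> B \<Longrightarrow> b \<bullet> z = 0"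
  obtains v e where "norm v = 1" "\<And>b. b \<in> B \<Longrightarrow> b \<bullet> v = 0" "A *v v = e *\<^sub>R v"
proof -
  have symA: "x \<bullet> (A *v y) = (A *v x) \<bullet> y" for x y :: "real^'n"
    by (metis dot_lmul_matrix sym transpose_matrix_vector)
  define S where "S = {x. \<forall>b\<in>B. b \<bullet> x = 0}"
  have S: "subspace S"
    by (auto simp: S_def subspace_def inner_add_right)
  have AS: "A *v x \<in> S" if "x \<in> S" for x
  proof -
    have "b \<bullet> (A *v x) = 0" if b: "b \<in> B" for b
    proof -
      obtain e where "A *v b = e *\<^sub>R b" using eig[OF b] by blast
      then show ?thesis using \<open>x \<in> S\<close> b by (simp add: symA S_def)
    qed
    then show ?thesis by (simp add: S_def)
  qed
  have "compact (S \<inter> sphere 0 1)"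
    by (simp add: S closed_subspace closed_Int_compact)
  moreover have "(1 / norm z) *\<^sub>R z \<in> S \<inter> sphere 0 1"
    using z by (auto simp: S_def)
  moreover have cA: "continuous_on (S \<inter> sphere 0 1) (\<lambda>x. x \<bullet> (A *v x))"
    by (intro continuous_intros matrix_vector_mult_linear_continuous_on)
  ultimately obtain v where "v \<in> S \<inter> sphere 0 1" "\<forall>x\<in>S \<inter> sphere 0 1. x \<bullet> (A *v x) \<le> v \<bullet> (A *v v)"
    using continuous_attains_sup[OF _ _ cA] by blast
  then have v: "v \<in> S" "norm v = 1"
    and max: "\<And>x. x \<in> S \<Longrightarrow> norm x = 1 \<Longrightarrow> x \<bullet> (A *v x) \<le> v \<bullet> (A *v v)"
    by auto
  define m where "m = v \<bullet> (A *v v)"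
  have le: "x \<bullet> (A *v x) \<le> m * (x \<bullet> x)" if "x \<in> S" for x
  proof (cases "x = 0")
    case False
    define y where "y = (1 / norm x) *\<^sub>R x"
    have "y \<in> S" "norm y = 1" using that False S by (auto simp: y_def subspace_scale)
    from max[OF this] have "y \<bullet> (A *v y) \<le> m" by (simp add: m_def)
    then have "(x \<bullet> (A *v x)) / (norm x)^2 \<le> m"
      by (simp add: y_def matrix_vector_mult_scaleR power2_eq_square)
    then show ?thesis
      using False by (simp add: divide_le_eq power2_norm_eq_inner)
  qed simp
  \<comment> \<open>The residual \<open>h\<close> is an admissible direction orthogonal to
    \<open>v\<close>. If it were nonzero, moving from \<open>v\<close> along \<open>h\<close> would
    raise the Rayleigh quotient to first order.\<close>
  define h where "h = A *v v - m *\<^sub>R v"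
  have vv: "v \<bullet> v = 1" using v by (simp add: norm_eq_1)
  have hS: "h \<in> S" using v AS S by (auto simp: h_def subspace_diff subspace_scale)
  have vh: "v \<bullet> h = 0" by (simp add: h_def inner_diff_right vv m_def)
  have hA: "h \<bullet> (A *v v) = h \<bullet> h"
  proof -
    have "A *v v = h + m *\<^sub>R v" by (simp add: h_def)
    then show ?thesis using vh by (simp add: inner_add_right inner_commute)
  qed
  have "h \<bullet> h = 0"
  proof (rule ccontr)
    assume "h \<bullet> h \<noteq> 0"
    then have hp: "h \<bullet> h > 0" by (simp add: order_less_le)
    define c where "c = h \<bullet> (A *v h)"
    have key: "2 * t * (h \<bullet> h) + t^2 * c \<le> m * t^2 * (h \<bullet> h)" for t
    proof -
      have "v + t *\<^sub>R h \<in> S" using v hS S by (simp add: subspace_add subspace_scale)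
      from le[OF this]
      have "m + 2 * t * (h \<bullet> h) + t^2 * c \<le> m * (1 + t^2 * (h \<bullet> h))"
        using hA vh vv symA[of v h]
        by (simp add: matrix_vector_right_distrib matrix_vector_mult_scaleR inner_add_left inner_add_right
            m_def c_def inner_commute algebra_simps power2_eq_square)
      then show ?thesis by (simp add: algebra_simps)
    qed
    \<comment> \<open>\<open>K\<close> bounds the coefficient of the quadratic error, so
      \<open>t = (h \<bullet> h) / K\<close> makes that error at most half of the linear
      gain.\<close>
    define K where "K = \<bar>m * (h \<bullet> h) - c\<bar> + 1"
    have K: "K > 0" "m * (h \<bullet> h) - c \<le> K" by (auto simp: K_def)
    define t where "t = (h \<bullet> h) / K"
    have t: "t > 0" using hp K by (simp add: t_def)
    have "2 * t * (h \<bullet> h) \<le> t^2 * (m * (h \<bullet> h) - c)" using key[of t] by (simp add: algebra_simps)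
    also have "\<dots> \<le> t^2 * K" using K by (intro mult_left_mono) auto
    also have "\<dots> = t * (h \<bullet> h)" using K by (simp add: t_def power2_eq_square)
    finally show False using t hp by simp
  qed
  then have "A *v v = m *\<^sub>R v" by (simp add: h_def)
  with v show thesis by (intro that[of v m]) (auto simp: S_def)
qed

text \<open>Orthonormal sets of eigenvectors are independent, hence bounded in size. One of greatest
  size spans, since otherwise its complement supplies a further eigenvector.\<close>

theorem symmetric_eigenframe:
  fixes A :: "real^'n^'n"
  assumes sym: "transpose A = A"
  obtains w e where "frame w" "\<And>i. A *v w i = e i *\<^sub>R w i"
proof -
  define good where "good B \<longleftrightarrow> pairwise orthogonal B \<and> (\<forall>b\<in>B. norm b = 1 \<and> (\<exists>e. A *v b = e *\<^sub>R b))"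
    for B :: "(real^'n) set"
  have ind: "independent B" if "good B" for B
    using that by (intro pairwise_orthogonal_independent) (auto simp: good_def)
  have fin: "finite B" if "good B" for B using ind[OF that] independent_imp_finite by blast
  have bound: "card B \<le> CARD('n)" if "good B" for B
    using independent_bound[OF ind[OF that]] by simp
  obtain B where B: "good B" and max: "\<And>B'. good B' \<Longrightarrow> card B' \<le> card B"
    using ex_has_greatest_nat[of good "{}" card "CARD('n) + 1"] bound
    by (force simp: good_def less_Suc_eq_le)
  have "span B = UNIV"
  proof (rule ccontr)
    assume "span B \<noteq> UNIV"
    then have "span B \<subset> span UNIV" by (simp add: psubset_eq)
    then obtain z where z: "z \<noteq> 0" "\<And>y. y \<in> span B \<Longrightarrow> orthogonal z y"
      using orthogonal_to_subspace_exists_gen by metis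
    obtain v e where v: "norm v = 1" "\<And>b. b \<in> B \<Longrightarrow> b \<bullet> v = 0" "A *v v = e *\<^sub>R v"
      using symmetric_eigenvector_on_complement[OF sym, of B z] B z
      by (auto simp: good_def orthogonal_def span_base inner_commute)
    have "v \<notin> B" using v by (auto simp: norm_eq_1)
    moreover have "good (insert v B)"
      using B v by (auto simp: good_def pairwise_insert orthogonal_def inner_commute)
    ultimately show False using max[of "insert v B"] fin[OF B] by simp
  qed
  then have "card B = CARD('n)"
    using dim_eq_card_independent[OF ind[OF B]] dim_span[of B] by simp
  then obtain w where w: "bij_betw w (UNIV :: 'n set) B"
    using finite_same_card_bij[of "UNIV :: 'n set" B] fin[OF B] by auto
  have wB: "w i \<in> B" for i using w by (auto simp: bij_betw_def)
  have "frame w"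
    unfolding frame_def
  proof (intro allI)
    fix i j
    show "w i \<bullet> w j = (if i = j then 1 else 0)"
    proof (cases "i = j")
      case True
      then show ?thesis using B wB by (simp add: good_def norm_eq_1)
    next
      case False
      then have "w i \<noteq> w j" using w by (auto simp: bij_betw_def inj_def)
      then show ?thesis using B wB False by (auto simp: good_def pairwise_def orthogonal_def)
    qed
  qed
  moreover have "\<forall>i. \<exists>e. A *v w i = e *\<^sub>R w i" using B wB by (auto simp: good_def)
  ultimately show thesis using that by metis
qed

text \<open>Eigenvalues count with multiplicity, so the determinant itself has to be diagonalised.
  \<open>P\<close> embeds real matrices as constant polynomial matrices and is multiplicative;
  \<open>X\<close> is scalar and commutes with everything.\<close>

lemma charpoly_eigenframe:
  fixes A :: "real^'n^'n"
  assumes w: "frame w" and e: "\<And>i. A *v w i = e i *\<^sub>R w i"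
  shows "charpoly A = (\<Prod>i\<in>UNIV. [:- e i, 1:])"
proof -
  define W :: "real^'n^'n" where "W = (\<chi> i. w i)"
  define D :: "real^'n^'n" where "D = (\<chi> i j. if i = j then e i else 0)"
  define P :: "real^'n^'n \<Rightarrow> real poly^'n^'n" where "P M = (\<chi> i j. [:M $ i $ j:])" for M
  define X :: "real poly^'n^'n" where "X = (\<chi> i j. if i = j then [:0,1:] else 0)"
  have W: "W ** transpose W = mat 1" "transpose W ** W = mat 1"
    using frame_orthogonal_matrix[OF w] by (auto simp: W_def orthogonal_matrix_def)
  have comp: "(\<Sum>k\<in>UNIV. A $ i $ k * w j $ k) = e j * w j $ i" for i j
    using arg_cong[OF e[of j], of "\<lambda>v. v $ i"] by (simp add: matrix_vector_mult_def)
  have AW: "A ** transpose W = transpose W ** D"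
    by (simp add: vec_eq_iff matrix_matrix_mult_def transpose_def W_def D_def comp if_distrib[of "\<lambda>x. _ * x"]
        cong: if_cong)
  have const_sum: "[:sum f S:] = (\<Sum>k\<in>S. [:f k:])" for f :: "'n \<Rightarrow> real" and S
    by (induction S rule: infinite_finite_induct) (simp_all, metis add_pCons add_0_right)
  have pm: "P (M ** N) = P M ** P N" for M N
    by (simp add: vec_eq_iff matrix_matrix_mult_def P_def const_sum mult.commute)
  have diff: "M ** (N - N') = M ** N - M ** N'" "(N - N') ** M = N ** M - N' ** M" for M N N' :: "real poly^'n^'n"
    by (simp_all add: vec_eq_iff matrix_matrix_mult_def sum_subtractf algebra_simps)
  have p1: "P (mat 1) = mat 1"
    by (simp add: vec_eq_iff P_def mat_def)
  have Xc: "X ** M = M ** X" for M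
    by (simp add: vec_eq_iff matrix_matrix_mult_def X_def if_distrib[of "\<lambda>x. _ * x"]
        if_distrib[of "\<lambda>x. x * _"] mult.commute cong: if_cong)
  have "charpoly A = det (X - P A)"
    by (auto simp: charpoly_def X_def P_def intro!: arg_cong[where f = det] simp: vec_eq_iff)
  also have "\<dots> = det (P W) * det (X - P A) * det (P (transpose W))"
  proof -
    have "det (P W) * det (P (transpose W)) = 1"
      using W by (simp flip: det_mul pm add: p1)
    then show ?thesis by (simp add: mult.commute mult.left_commute)
  qed
  also have "\<dots> = det (P W ** (X - P A) ** P (transpose W))"
    by (simp add: det_mul)
  also have "P W ** (X - P A) ** P (transpose W) = X - P D"
  proof -
    have "P W ** (X - P A) ** P (transpose W) = P W ** X ** P (transpose W) - P W ** (P A ** P (transpose W))"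
      by (simp add: diff matrix_mul_assoc)
    also have "P W ** X ** P (transpose W) = X ** (P W ** P (transpose W))"
      by (simp add: Xc matrix_mul_assoc)
    also have "P W ** P (transpose W) = mat 1" using W by (simp flip: pm add: p1)
    also have "P W ** (P A ** P (transpose W)) = P (W ** (transpose W ** D))"
      by (simp flip: pm add: AW)
    also have "W ** (transpose W ** D) = D" using W by (simp add: matrix_mul_assoc)
    finally show ?thesis by simp
  qed
  also have "det (X - P D) = (\<Prod>i\<in>UNIV. (X - P D) $ i $ i)"
    by (rule det_diagonal) (simp add: X_def P_def D_def)
  also have "\<dots> = (\<Prod>i\<in>UNIV. [:- e i, 1:])"
    by (simp add: X_def P_def D_def)
  finally show ?thesis .
qed

lemma pucci_minus_eigenframe:
  fixes A :: "real^'n^'n"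
  assumes sym: "transpose A = A" and lL: "l \<le> L"
  obtains w \<theta> where "frame w" "\<And>i. l \<le> \<theta> i \<and> \<theta> i \<le> L"
    "pucci_minus l L A = (\<Sum>i\<in>UNIV. \<theta> i * (w i \<bullet> (A *v w i)))"
proof -
  obtain w e where w: "frame w" and e: "\<And>i. A *v w i = e i *\<^sub>R w i"
    using symmetric_eigenframe[OF sym] by blast
  have "eigenvalues A = (\<Sum>i\<in>UNIV. {#e i#})"
    unfolding eigenvalues_def charpoly_eigenframe[OF w e]
    by (subst proots_prod) auto
  also have "\<dots> = image_mset e (mset_set UNIV)"
    by (simp add: sum_unfold_sum_mset)
  finally have ev: "eigenvalues A = image_mset e (mset_set UNIV)" .
  \<comment> \<open>A zero eigenvalue receives the weight \<open>L\<close>, harmlessly, since it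
    contributes nothing.\<close>
  define \<theta> where "\<theta> i = (if e i > 0 then l else L)" for i
  have pos: "sum_mset {#x \<in># eigenvalues A. 0 < x#} = (\<Sum>i\<in>UNIV. if e i > 0 then e i else 0)"
    and neg: "sum_mset {#x \<in># eigenvalues A. x < 0#} = (\<Sum>i\<in>UNIV. if e i < 0 then e i else 0)"
    by (simp_all add: ev filter_mset_image_mset sum_unfold_sum_mset[symmetric] sum.If_cases)
  have "pucci_minus l L A = (\<Sum>i\<in>UNIV. \<theta> i * (w i \<bullet> (A *v w i)))"
    unfolding pucci_minus_def pos neg sum_distrib_left sum.distrib[symmetric]
    by (intro sum.cong) (auto simp: \<theta>_def e frame_inner_self[OF w])
  then show thesis using w lL by (intro that[of w \<theta>]) (auto simp: \<theta>_def)
qed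

text \<open>\<open>pucci_minus l L A\<close> is attained at some frame and weights in \<open>[l, L]\<close>, so the following bound
  on the quadratic form of \<open>A\<close> forces \<open>B \<le> pucci_minus l L A\<close> without computing any eigenvalue.\<close>

definition pucci_ge :: "real \<Rightarrow> real \<Rightarrow> (real^'n::finite \<Rightarrow> real) \<Rightarrow> real \<Rightarrow> bool" where
  "pucci_ge l L Q B \<longleftrightarrow>
     (\<forall>(w :: 'n \<Rightarrow> real^'n) \<theta>. frame w \<longrightarrow> (\<forall>i. l \<le> \<theta> i \<and> \<theta> i \<le> L) \<longrightarrow> B \<le> (\<Sum>i\<in>UNIV. \<theta> i * Q (w i)))"

lemma pucci_ge_pucci_minus:
  assumes "transpose A = A" "l \<le> L" "pucci_ge l L (\<lambda>h. h \<bullet> (A *v h)) B"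
  shows "B \<le> pucci_minus l L A"
  using pucci_minus_eigenframe[OF assms(1,2)] assms(3) unfolding pucci_ge_def by metis

lemma pucci_ge_add:
  assumes "pucci_ge l L Q B" "pucci_ge l L Q' B'"
  shows "pucci_ge l L (\<lambda>h. Q h + Q' h) (B + B')"
  using assms by (auto simp: pucci_ge_def distrib_left sum.distrib intro!: add_mono)

lemma pucci_ge_cmult:
  assumes "pucci_ge l L Q B" "c \<ge> 0"
  shows "pucci_ge l L (\<lambda>h. c * Q h) (c * B)"
  unfolding pucci_ge_def
proof (intro allI impI)
  fix w :: "'a \<Rightarrow> real^'a" and \<theta> :: "'a \<Rightarrow> real" assume "frame w" "\<forall>i. l \<le> \<theta> i \<and> \<theta> i \<le> L"
  then have "B \<le> (\<Sum>i\<in>UNIV. \<theta> i * Q (w i))" using assms by (auto simp: pucci_ge_def)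
  from mult_left_mono[OF this \<open>c \<ge> 0\<close>] show "c * B \<le> (\<Sum>i\<in>UNIV. \<theta> i * (c * Q (w i)))"
    by (simp add: sum_distrib_left mult.left_commute)
qed

lemma pucci_ge_mono:
  assumes "pucci_ge l L Q B" "\<And>h. Q h \<le> Q' h" "B' \<le> B" "0 \<le> l"
  shows "pucci_ge l L Q' B'"
  unfolding pucci_ge_def
proof (intro allI impI)
  fix w :: "'a \<Rightarrow> real^'a" and \<theta> :: "'a \<Rightarrow> real" assume *: "frame w" "\<forall>i. l \<le> \<theta> i \<and> \<theta> i \<le> L"
  then have "B \<le> (\<Sum>i\<in>UNIV. \<theta> i * Q (w i))" using assms by (auto simp: pucci_ge_def)
  also have "\<dots> \<le> (\<Sum>i\<in>UNIV. \<theta> i * Q' (w i))"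
    using assms(2,4) * by (intro sum_mono mult_left_mono) (auto intro: order_trans)
  finally show "B' \<le> (\<Sum>i\<in>UNIV. \<theta> i * Q' (w i))" using assms(3) by simp
qed

text \<open>If \<open>Q = (Q + N) - N\<close> with both parts nonnegative, each \<open>\<theta>\<close> may be replaced by \<open>l\<close> on \<open>Q + N\<close>
  and by \<open>L\<close> on \<open>N\<close>.\<close>

lemma pucci_ge_split:
  fixes Q N :: "real^'n::finite \<Rightarrow> real"
  assumes N: "\<And>h. 0 \<le> N h" "\<And>h. 0 \<le> Q h + N h"
    and tr: "\<And>w. frame w \<Longrightarrow> (\<Sum>i\<in>UNIV. Q (w i)) = trQ" "\<And>w. frame w \<Longrightarrow> (\<Sum>i\<in>UNIV. N (w i)) = trN"
  shows "pucci_ge l L Q (l * trQ - (L - l) * trN)"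
  unfolding pucci_ge_def
proof (intro allI impI)
  fix w :: "'n \<Rightarrow> real^'n" and \<theta> :: "'n \<Rightarrow> real" assume *: "frame w" "\<forall>i. l \<le> \<theta> i \<and> \<theta> i \<le> L"
  have "l * trQ - (L - l) * trN = (\<Sum>i\<in>UNIV. l * Q (w i) - (L - l) * N (w i))"
    using tr[OF *(1)] by (simp add: sum_subtractf flip: sum_distrib_left)
  also have "\<dots> \<le> (\<Sum>i\<in>UNIV. \<theta> i * Q (w i))"
  proof (intro sum_mono)
    fix i
    have "0 \<le> (\<theta> i - l) * (Q (w i) + N (w i))" using * N by simp
    moreover have "0 \<le> (L - \<theta> i) * N (w i)" using * N by simp
    ultimately show "l * Q (w i) - (L - l) * N (w i) \<le> \<theta> i * Q (w i)" by (simp add: algebra_simps)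
  qed
  finally show "l * trQ - (L - l) * trN \<le> (\<Sum>i\<in>UNIV. \<theta> i * Q (w i))" .
qed

lemma pucci_ge_inner_sq: "0 \<le> l \<Longrightarrow> pucci_ge l L (\<lambda>h. (v \<bullet> h)\<^sup>2) (l * (v \<bullet> v))"
  using pucci_ge_split[of "\<lambda>_. 0" "\<lambda>h. (v \<bullet> h)\<^sup>2" "v \<bullet> v" 0 l L] by (simp add: frame_sum_inner_sq)

lemma pucci_ge_neg_norm_sq:
  "0 \<le> c \<Longrightarrow> pucci_ge l L (\<lambda>h::real^'n. - (c * (h \<bullet> h))) (- (L * c * real CARD('n)))"
  using pucci_ge_split[of "\<lambda>h::real^'n. c * (h \<bullet> h)" "\<lambda>h. - (c * (h \<bullet> h))" "- (c * real CARD('n))" "c * real CARD('n)" l L]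
  by (simp add: frame_inner_self algebra_simps)

subsection \<open>Pointwise second derivatives as test functions\<close>

text \<open>The first derivative is required near \<open>x\<close>, the second at \<open>x\<close>
  alone. Symmetry is a clause that each closure rule carries along, because the Hessian is
  diagonalised later.\<close>

definition twice_diff ::
  "(real^'n \<Rightarrow> real) \<Rightarrow> real^'n \<Rightarrow> real^'n \<Rightarrow> (real^'n \<Rightarrow> real^'n) \<Rightarrow> bool" where
  "twice_diff f x g H \<longleftrightarrow> (\<exists>Df. (\<forall>\<^sub>F y in nhds x. (f has_derivative (\<lambda>h. Df y \<bullet> h)) (at y)) \<and>
     Df x = g \<and> (Df has_derivative H) (at x)) \<and> (\<forall>h k. h \<bullet> H k = k \<bullet> H h)"

lemma twice_diff_const: "twice_diff (\<lambda>_. c) x 0 (\<lambda>_. 0)"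
proof -
  have zero: "(\<lambda>h. 0 \<bullet> h) = (\<lambda>_::real^'a. 0 :: real)" by simp
  show ?thesis
    unfolding twice_diff_def by (intro conjI exI[of _ "\<lambda>_. 0"] always_eventually) (auto simp: zero)
qed

lemma twice_diff_inner: "twice_diff (\<lambda>y. v \<bullet> (y - c)) x v (\<lambda>_. 0)"
  unfolding twice_diff_def
  by (auto intro!: exI[of _ "\<lambda>_. v"] always_eventually derivative_eq_intros)

lemma twice_diff_norm_sq: "twice_diff (\<lambda>y. (y - c) \<bullet> (y - c)) x (2 *\<^sub>R (x - c)) (\<lambda>h. 2 *\<^sub>R h)"
  unfolding twice_diff_def
  by (auto intro!: exI[of _ "\<lambda>y. 2 *\<^sub>R (y - c)"] always_eventually derivative_eq_intros
      simp: inner_commute fun_eq_iff algebra_simps)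

lemma twice_diff_add:
  assumes "twice_diff f x g H" "twice_diff f' x g' H'"
  shows "twice_diff (\<lambda>y. f y + f' y) x (g + g') (\<lambda>h. H h + H' h)"
proof -
  obtain Df where 1: "\<forall>\<^sub>F y in nhds x. (f has_derivative (\<lambda>h. Df y \<bullet> h)) (at y)" "Df x = g" "(Df has_derivative H) (at x)"
    using assms(1) by (auto simp: twice_diff_def)
  obtain Df' where 2: "\<forall>\<^sub>F y in nhds x. (f' has_derivative (\<lambda>h. Df' y \<bullet> h)) (at y)" "Df' x = g'" "(Df' has_derivative H') (at x)"
    using assms(2) by (auto simp: twice_diff_def)
  have "\<forall>\<^sub>F y in nhds x. ((\<lambda>y. f y + f' y) has_derivative (\<lambda>h. (Df y + Df' y) \<bullet> h)) (at y)"
    using 1(1) 2(1) by eventually_elim (auto intro!: derivative_eq_intros simp: inner_add_left)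
  moreover have "((\<lambda>y. Df y + Df' y) has_derivative (\<lambda>h. H h + H' h)) (at x)"
    using 1 2 by (auto intro!: derivative_eq_intros)
  ultimately show ?thesis
    using 1 2 assms unfolding twice_diff_def inner_add_right by (intro conjI exI[of _ "\<lambda>y. Df y + Df' y"]) auto
qed

lemma twice_diff_mult:
  assumes "twice_diff f x g H" "twice_diff f' x g' H'"
  shows "twice_diff (\<lambda>y. f y * f' y) x (f x *\<^sub>R g' + f' x *\<^sub>R g)
     (\<lambda>h. (f x *\<^sub>R H' h + (g \<bullet> h) *\<^sub>R g') + (f' x *\<^sub>R H h + (g' \<bullet> h) *\<^sub>R g))"
proof -
  obtain Df where 1: "\<forall>\<^sub>F y in nhds x. (f has_derivative (\<lambda>h. Df y \<bullet> h)) (at y)" "Df x = g" "(Df has_derivative H) (at x)"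
    using assms(1) by (auto simp: twice_diff_def)
  obtain Df' where 2: "\<forall>\<^sub>F y in nhds x. (f' has_derivative (\<lambda>h. Df' y \<bullet> h)) (at y)" "Df' x = g'" "(Df' has_derivative H') (at x)"
    using assms(2) by (auto simp: twice_diff_def)
  have "\<forall>\<^sub>F y in nhds x. ((\<lambda>y. f y * f' y) has_derivative (\<lambda>h. (f y *\<^sub>R Df' y + f' y *\<^sub>R Df y) \<bullet> h)) (at y)"
    using 1(1) 2(1)
    by eventually_elim (auto intro!: derivative_eq_intros simp: inner_add_left algebra_simps)
  moreover have "(f has_derivative (\<lambda>h. g \<bullet> h)) (at x)" "(f' has_derivative (\<lambda>h. g' \<bullet> h)) (at x)"
    using 1 2 by (auto dest!: eventually_nhds_x_imp_x)
  then have "((\<lambda>y. f y *\<^sub>R Df' y + f' y *\<^sub>R Df y) has_derivative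
      (\<lambda>h. (f x *\<^sub>R H' h + (g \<bullet> h) *\<^sub>R g') + (f' x *\<^sub>R H h + (g' \<bullet> h) *\<^sub>R g))) (at x)"
    using 1(2,3) 2(2,3) by (auto intro!: has_derivative_add has_derivative_scaleR[THEN has_derivative_eq_rhs])
  moreover have "\<forall>h k. h \<bullet> H k = k \<bullet> H h" "\<forall>h k. h \<bullet> H' k = k \<bullet> H' h"
    using assms by (auto simp: twice_diff_def)
  then have "\<forall>h k. h \<bullet> ((f x *\<^sub>R H' k + (g \<bullet> k) *\<^sub>R g') + (f' x *\<^sub>R H k + (g' \<bullet> k) *\<^sub>R g)) =
      k \<bullet> ((f x *\<^sub>R H' h + (g \<bullet> h) *\<^sub>R g') + (f' x *\<^sub>R H h + (g' \<bullet> h) *\<^sub>R g))"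
    by (simp add: inner_add_right inner_commute)
  ultimately show ?thesis
    using 1(2) 2(2) unfolding twice_diff_def
    by (intro conjI exI[of _ "\<lambda>y. f y *\<^sub>R Df' y + f' y *\<^sub>R Df y"]) auto
qed

lemma twice_diff_cmult:
  assumes "twice_diff f x g H"
  shows "twice_diff (\<lambda>y. c * f y) x (c *\<^sub>R g) (\<lambda>h. c *\<^sub>R H h)"
  using twice_diff_mult[OF twice_diff_const[of c x] assms] by simp

lemma twice_diff_compose:
  assumes f: "twice_diff f x g H"
    and F: "\<forall>\<^sub>F s in nhds (f x). (F has_real_derivative F' s) (at s)" "(F' has_real_derivative F2) (at (f x))"
  shows "twice_diff (\<lambda>y. F (f y)) x (F' (f x) *\<^sub>R g) (\<lambda>h. F' (f x) *\<^sub>R H h + (F2 * (g \<bullet> h)) *\<^sub>R g)"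
proof -
  obtain Df where 1: "\<forall>\<^sub>F y in nhds x. (f has_derivative (\<lambda>h. Df y \<bullet> h)) (at y)" "Df x = g" "(Df has_derivative H) (at x)"
    using f by (auto simp: twice_diff_def)
  then have fx: "(f has_derivative (\<lambda>h. g \<bullet> h)) (at x)" by (auto dest!: eventually_nhds_x_imp_x)
  then have "isCont f x" using has_derivative_continuous by blast
  then have "filterlim f (nhds (f x)) (nhds x)" by (simp add: continuous_at filterlim_at_split tendsto_at_iff_tendsto_nhds isCont_def)
  from eventually_compose_filterlim[OF F(1) this] 1(1)
  have "\<forall>\<^sub>F y in nhds x. ((\<lambda>y. F (f y)) has_derivative (\<lambda>h. (F' (f y) *\<^sub>R Df y) \<bullet> h)) (at y)"
    by eventually_elim
       (auto intro: has_derivative_compose[THEN has_derivative_eq_rhs] simp: has_field_derivative_def)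
  moreover have "((\<lambda>y. F' (f y)) has_derivative (\<lambda>h. F2 * (g \<bullet> h))) (at x)"
    using has_derivative_compose[OF fx, of F'] F(2) by (auto simp: has_field_derivative_def)
  then have "((\<lambda>y. F' (f y) *\<^sub>R Df y) has_derivative (\<lambda>h. F' (f x) *\<^sub>R H h + (F2 * (g \<bullet> h)) *\<^sub>R g)) (at x)"
    using 1(2,3) by (auto intro!: has_derivative_scaleR[THEN has_derivative_eq_rhs])
  moreover have "\<forall>h k. h \<bullet> (F' (f x) *\<^sub>R H k + (F2 * (g \<bullet> k)) *\<^sub>R g) = k \<bullet> (F' (f x) *\<^sub>R H h + (F2 * (g \<bullet> h)) *\<^sub>R g)"
    using f by (simp add: inner_add_right inner_commute twice_diff_def)
  ultimately show ?thesis
    using 1(2) unfolding twice_diff_def by (intro conjI exI[of _ "\<lambda>y. F' (f y) *\<^sub>R Df y"]) blast+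
qed

lemma twice_diff_cong:
  assumes "twice_diff f x g H" "\<forall>\<^sub>F y in nhds x. f y = f' y"
  shows "twice_diff f' x g H"
proof -
  obtain Df where 1: "\<forall>\<^sub>F y in nhds x. (f has_derivative (\<lambda>h. Df y \<bullet> h)) (at y)" "Df x = g" "(Df has_derivative H) (at x)"
    using assms(1) by (auto simp: twice_diff_def)
  have "\<forall>\<^sub>F y in nhds x. \<forall>\<^sub>F z in nhds y. f z = f' z" using assms(2) by (simp add: eventually_eventually)
  with 1(1) have "\<forall>\<^sub>F y in nhds x. (f' has_derivative (\<lambda>h. Df y \<bullet> h)) (at y)"
  proof eventually_elim
    case (elim y)
    then have "f y = f' y" "\<forall>\<^sub>F z in at y. f z = f' z"
      by (auto dest: eventually_nhds_x_imp_x simp: eventually_at_filter elim: eventually_mono)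
    then show ?case using elim(1) has_derivative_transform_eventually by blast
  qed
  then show ?thesis using 1(2,3) assms(1) unfolding twice_diff_def by blast
qed

lemma twice_diff_shift:
  assumes "twice_diff f (x - c) g H"
  shows "twice_diff (\<lambda>y. f (y - c)) x g H"
proof -
  obtain Df where 1: "\<forall>\<^sub>F y in nhds (x - c). (f has_derivative (\<lambda>h. Df y \<bullet> h)) (at y)" "Df (x - c) = g" "(Df has_derivative H) (at (x - c))"
    using assms(1) by (auto simp: twice_diff_def)
  have lim: "filterlim (\<lambda>y. y - c) (nhds (x - c)) (nhds x)"
    by (intro tendsto_intros filterlim_ident)
  have shift: "((\<lambda>y. y - c) has_derivative (\<lambda>h. h)) (at y)" for y
    by (auto intro!: derivative_eq_intros)
  have "\<forall>\<^sub>F y in nhds x. ((\<lambda>y. f (y - c)) has_derivative (\<lambda>h. Df (y - c) \<bullet> h)) (at y)"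
    using eventually_compose_filterlim[OF 1(1) lim]
    by eventually_elim (use has_derivative_compose[OF shift] in blast)
  moreover have "((\<lambda>y. Df (y - c)) has_derivative H) (at x)"
    using has_derivative_compose[OF shift 1(3)] by simp
  ultimately show ?thesis using 1(2) assms unfolding twice_diff_def by (intro conjI exI[of _ "\<lambda>y. Df (y - c)"]) auto
qed

text \<open>The mean value theorem is applied to the remainder along the segment from
  \<open>x\<close> to \<open>x + h\<close>; its derivative \<open>F'\<close> is controlled by the
  differentiability of \<open>Df\<close> at the single point \<open>x\<close>.\<close>

lemma peano_expansion:
  fixes f :: "real^'n \<Rightarrow> real"
  assumes "\<forall>\<^sub>F y in nhds x. (f has_derivative (\<lambda>h. Df y \<bullet> h)) (at y)" "(Df has_derivative H) (at x)" "\<epsilon> > 0"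
  obtains r where "r > 0"
    "\<And>h. norm h < r \<Longrightarrow> \<bar>f (x + h) - f x - Df x \<bullet> h - (h \<bullet> H h) / 2\<bar> \<le> \<epsilon> * (norm h)\<^sup>2"
proof -
  obtain r1 where r1: "r1 > 0" "\<And>y. dist y x < r1 \<Longrightarrow> (f has_derivative (\<lambda>h. Df y \<bullet> h)) (at y)"
    using assms(1) by (auto simp: eventually_nhds_metric)
  obtain r2 where r2: "r2 > 0"
    "\<And>y. norm (y - x) < r2 \<Longrightarrow> norm (Df y - Df x - H (y - x)) \<le> \<epsilon> * norm (y - x)"
    using assms(2,3) by (auto simp: has_derivative_at_alt)
  have linH: "linear H" using assms(2) has_derivative_linear by blast
  show thesis
  proof (rule that[of "min r1 r2"])
    fix h :: "real^'n" assume h: "norm h < min r1 r2"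
    define F where "F t = f (x + t *\<^sub>R h) - t * (Df x \<bullet> h) - t\<^sup>2 * (h \<bullet> H h) / 2" for t
    define F' where "F' t = Df (x + t *\<^sub>R h) \<bullet> h - Df x \<bullet> h - t * (h \<bullet> H h)" for t
    have th: "norm (t *\<^sub>R h) < r1" "norm (t *\<^sub>R h) < r2" if "0 \<le> t" "t \<le> 1" for t
      using that h mult_left_le_one_le[of "norm h" t] by auto
    have der: "(F has_real_derivative F' t) (at t)" if t: "0 \<le> t" "t \<le> 1" for t
    proof -
      have "((\<lambda>t. x + t *\<^sub>R h) has_derivative (\<lambda>s. s *\<^sub>R h)) (at t)"
        by (auto intro!: derivative_eq_intros)
      from has_derivative_compose[OF this r1(2)[of "x + t *\<^sub>R h"]]
      have "((\<lambda>t. f (x + t *\<^sub>R h)) has_real_derivative Df (x + t *\<^sub>R h) \<bullet> h) (at t)"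
        using th(1)[OF t] by (simp add: dist_norm has_field_derivative_def mult.commute[of _ "Df _ \<bullet> h"])
      then show ?thesis
        unfolding F_def F'_def by (auto intro!: derivative_eq_intros)
    qed
    obtain t where t: "0 < t" "t < 1" "F 1 - F 0 = F' t"
      using MVT2[of 0 1 F F'] der by auto
    have "F' t = (Df (x + t *\<^sub>R h) - Df x - H (t *\<^sub>R h)) \<bullet> h"
      by (simp add: F'_def inner_diff_left linear_scale[OF linH] inner_commute[of h "H h"])
    then have "\<bar>F' t\<bar> \<le> norm (Df (x + t *\<^sub>R h) - Df x - H (t *\<^sub>R h)) * norm h"
      by (simp add: Cauchy_Schwarz_ineq2)
    also have "\<dots> \<le> (\<epsilon> * norm (t *\<^sub>R h)) * norm h"
      using r2(2)[of "x + t *\<^sub>R h"] th(2)[of t] t by (intro mult_right_mono) auto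
    also have "\<dots> \<le> \<epsilon> * (norm h)\<^sup>2"
      using t assms(3) by (simp add: power2_eq_square mult_left_le_one_le)
    finally show "\<bar>f (x + h) - f x - Df x \<bullet> h - (h \<bullet> H h) / 2\<bar> \<le> \<epsilon> * (norm h)\<^sup>2"
      using t(3) by (simp add: F_def)
  qed (use r1 r2 in auto)
qed

text \<open>The Taylor polynomial of \<open>\<phi>\<close> minus \<open>\<epsilon> |h|\<^sup>2\<close> still touches from below and is \<open>C\<^sup>2\<close> on all of \<open>S\<close>, so
  barriers with singularities inside \<open>S\<close> are admissible.\<close>

lemma visc_supersol_twice_diff:
  fixes u :: "real^'n \<Rightarrow> real"
  assumes u: "visc_supersol l L S u f" and lL: "0 \<le> l" "l \<le> L"
    and min: "local_min_on S (\<lambda>x. u x - \<phi> x) x" and \<phi>: "twice_diff \<phi> x g H"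
    and B: "pucci_ge l L (\<lambda>h. h \<bullet> H h) B"
  shows "B + f x \<le> 0"
proof (rule field_le_epsilon)
  fix e :: real assume "e > 0"
  \<comment> \<open>The correction \<open>\<epsilon> |h|^2\<close> costs
    \<open>2 \<epsilon> L n = e L / (L + 1)\<close>, which is at most \<open>e\<close>; the
    \<open>+ 1\<close> also covers \<open>L = 0\<close>.\<close>
  define \<epsilon> where "\<epsilon> = e / (2 * (L + 1) * real CARD('n))"
  have \<epsilon>: "\<epsilon> > 0" using \<open>e > 0\<close> lL by (simp add: \<epsilon>_def)
  obtain Df where Df: "\<forall>\<^sub>F y in nhds x. (\<phi> has_derivative (\<lambda>h. Df y \<bullet> h)) (at y)" "Df x = g"
    "(Df has_derivative H) (at x)" and sym: "\<And>h k. h \<bullet> H k = k \<bullet> H h"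
    using \<phi> by (auto simp: twice_diff_def)
  have linH: "linear H" using Df(3) has_derivative_linear by blast
  obtain r where r: "r > 0"
    "\<And>h. norm h < r \<Longrightarrow> \<bar>\<phi> (x + h) - \<phi> x - Df x \<bullet> h - (h \<bullet> H h) / 2\<bar> \<le> \<epsilon> * (norm h)\<^sup>2"
    using peano_expansion[OF Df(1,3) \<epsilon>] by blast
  define A where "A = matrix H - (2 * \<epsilon>) *\<^sub>R mat 1"
  have A: "A *v h = H h - (2 * \<epsilon>) *\<^sub>R h" for h
    by (simp add: A_def matrix_vector_mult_diff_rdistrib matrix_works linH flip: scaleR_matrix_vector_assoc)
  have symA: "transpose A = A"
  proof -
    have "A $ i $ j = A $ j $ i" for i j
    proof -
      have "axis a 1 \<bullet> (A *v axis b 1) = A $ a $ b" for a b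
        by (simp add: inner_axis' matrix_vector_mul_component inner_axis)
      then show ?thesis
        unfolding A by (metis (no_types, lifting) inner_commute inner_diff_right inner_scaleR_right sym)
    qed
    then show ?thesis by (simp add: transpose_def vec_eq_iff)
  qed
  define P where "P y = g \<bullet> (y - x) + ((y - x) \<bullet> (A *v (y - x))) / 2" for y
  have "C2_on S P (\<lambda>y. g + A *v (y - x)) (\<lambda>_. A)"
    unfolding C2_on_def
  proof (intro conjI ballI)
    fix y assume "y \<in> S"
    have dA: "((\<lambda>y. A *v (y - x)) has_derivative (\<lambda>h. A *v h)) (at y)"
      by (auto intro!: derivative_eq_intros bounded_linear.has_derivative[OF matrix_vector_mul_bounded_linear])
    then show "((\<lambda>y. g + A *v (y - x)) has_derivative (\<lambda>h. A *v h)) (at y)"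
      by (auto intro!: derivative_eq_intros)
    have swap: "h \<bullet> (A *v k) = k \<bullet> (A *v h)" for h k
      by (simp add: A inner_diff_right sym[of h k] inner_commute)
    have "(P has_derivative (\<lambda>h. g \<bullet> h + ((y - x) \<bullet> (A *v h) + h \<bullet> (A *v (y - x))) / 2)) (at y)"
      unfolding P_def using dA by (auto intro!: derivative_eq_intros)
    then show "(P has_derivative (\<lambda>h. (g + A *v (y - x)) \<bullet> h)) (at y)"
      by (simp add: swap[of "y - x"] inner_add_left inner_commute[of "A *v (y - x)"])
  qed simp
  moreover have "local_min_on S (\<lambda>y. u y - P y) x"
  proof -
    obtain s where s: "s > 0" "\<And>y. y \<in> S \<Longrightarrow> dist y x < s \<Longrightarrow> u x - \<phi> x \<le> u y - \<phi> y" and xS: "x \<in> S"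
      using min by (auto simp: local_min_on_def)
    have "u x - P x \<le> u y - P y" if "y \<in> S" "dist y x < min r s" for y
    proof -
      define h where "h = y - x"
      have "norm h < r" using that by (simp add: h_def dist_norm)
      from r(2)[OF this] have "\<phi> y - \<phi> x \<ge> g \<bullet> h + (h \<bullet> H h) / 2 - \<epsilon> * (norm h)\<^sup>2"
        by (simp add: h_def Df(2) abs_le_iff)
      also have "g \<bullet> h + (h \<bullet> H h) / 2 - \<epsilon> * (norm h)\<^sup>2 = P y - P x"
        by (simp add: P_def A inner_diff_right power2_norm_eq_inner flip: h_def)
      finally show ?thesis using s(2)[of y] that by simp
    qed
    then show ?thesis using xS r(1) s(1) unfolding local_min_on_def by (intro conjI exI[of _ "min r s"]) auto
  qed
  ultimately have "pucci_minus l L A + f x \<le> 0"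
    using u unfolding visc_supersol_def by blast
  moreover have "pucci_ge l L (\<lambda>h. h \<bullet> H h + - (2 * \<epsilon> * (h \<bullet> h))) (B + - (L * (2 * \<epsilon>) * real CARD('n)))"
    by (intro pucci_ge_add pucci_ge_neg_norm_sq B) (use \<epsilon> in auto)
  then have "B - L * (2 * \<epsilon>) * real CARD('n) \<le> pucci_minus l L A"
    using pucci_ge_pucci_minus[OF symA lL(2)] by (simp add: A inner_diff_right)
  moreover have "L * (2 * \<epsilon>) * real CARD('n) = e * (L / (L + 1))"
    using lL by (simp add: \<epsilon>_def divide_simps)
  moreover have "e * (L / (L + 1)) \<le> e * 1"
    using \<open>e > 0\<close> lL by (intro mult_left_mono) (auto simp: divide_le_eq_1)
  ultimately show "B + f x \<le> 0 + e" by linarith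
qed

subsection \<open>Comparison, growth and the strong minimum principle\<close>

lemma half_space_inner: "half_space k = {x. axis k 1 \<bullet> x > 0}"
  by (simp add: half_space_def inner_axis')

lemma open_half_space: "open (half_space k)"
  unfolding half_space_inner by (rule open_halfspace_gt)

lemma connected_half_space: "connected (half_space k)"
  unfolding half_space_inner by (intro convex_connected convex_halfspace_gt)

text \<open>A minimum of \<open>u - \<phi>\<close> over \<open>K\<close> inside \<open>U\<close>
  would make \<open>\<phi>\<close> a test function there, which the strict inequality
  \<open>B + f x > 0\<close> forbids; so the minimum lies in \<open>K - U\<close>.\<close>

lemma visc_comparison:
  fixes u \<phi> :: "real^'n \<Rightarrow> real"
  assumes u: "visc_supersol l L S u f" and lL: "0 \<le> l" "l \<le> L"
    and K: "compact K" "K \<subseteq> S" and U: "open U" "U \<subseteq> K"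
    and cont: "continuous_on K u" "continuous_on K \<phi>"
    and bd: "\<And>x. x \<in> K - U \<Longrightarrow> \<phi> x \<le> u x"
    and sub: "\<And>x. x \<in> U \<Longrightarrow>
      \<exists>g H B. twice_diff \<phi> x g H \<and> pucci_ge l L (\<lambda>h. h \<bullet> H h) B \<and> B + f x > 0"
    and x: "x \<in> K"
  shows "\<phi> x \<le> u x"
proof -
  have "continuous_on K (\<lambda>x. u x - \<phi> x)" using cont by (intro continuous_intros)
  then obtain z where z: "z \<in> K" "\<And>y. y \<in> K \<Longrightarrow> u z - \<phi> z \<le> u y - \<phi> y"
    using continuous_attains_inf[OF K(1), of "\<lambda>x. u x - \<phi> x"] x by blast
  have "0 \<le> u z - \<phi> z"
  proof (cases "z \<in> U")
    case True
    then obtain r where r: "r > 0" "ball z r \<subseteq> U" using U(1) by (auto simp: open_contains_ball)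
    have "local_min_on S (\<lambda>x. u x - \<phi> x) z"
      unfolding local_min_on_def
      using r U(2) K(2) z by (intro conjI exI[of _ r]) (auto simp: dist_commute subset_iff)
    then show ?thesis
      using sub[OF True] visc_supersol_twice_diff[OF u lL] by (meson not_le)
  qed (use bd z in auto)
  then show ?thesis using z(2)[OF x] by simp
qed

text \<open>The barrier vanishes on the outer sphere, where only \<open>u \<ge> 0\<close> is known.
  Its radial convexity outweighs the isotropic concave part once
  \<open>2 t l |x - y|^2 > n L\<close>, and \<open>t\<close> ensures this outside the ball of radius
  \<open>\<rho>\<close>.\<close>

lemma gaussian_lower_bound:
  fixes u :: "real^'n \<Rightarrow> real"
  assumes u: "visc_supersol l L S u f" and lL: "0 < l" "l \<le> L"
    and f: "\<And>x. x \<in> S \<Longrightarrow> 0 \<le> f x" and cont: "continuous_on S u" and pos: "\<And>x. x \<in> S \<Longrightarrow> 0 \<le> u x"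
    and S: "cball y \<sigma> \<subseteq> S" and \<rho>: "0 < \<rho>" "\<rho> < \<sigma>"
    and m: "0 \<le> m" "\<And>x. x \<in> cball y \<rho> \<Longrightarrow> m \<le> u x"
    and x: "x \<in> cball y \<sigma>"
    and t: "t = real CARD('n) * L / (l * \<rho>\<^sup>2)"
  shows "m * (exp (- t * (norm (x - y))\<^sup>2) - exp (- t * \<sigma>\<^sup>2)) \<le> u x"
proof -
  have n: "real CARD('n) > 0" by simp
  have t0: "t > 0" using lL \<rho> n by (auto simp: t)
  define \<phi> where "\<phi> x = m * (exp (- t * (norm (x - y))\<^sup>2) - exp (- t * \<sigma>\<^sup>2))" for x
  have \<phi>m: "\<phi> x \<le> m" for x
  proof -
    have "exp (- t * (norm (x - y))\<^sup>2) \<le> 1" using t0 by simp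
    then have "exp (- t * (norm (x - y))\<^sup>2) - exp (- t * \<sigma>\<^sup>2) \<le> 1" by (simp add: add_increasing2 diff_le_eq)
    then show ?thesis using m(1) unfolding \<phi>_def by (metis mult.right_neutral mult_left_mono)
  qed
  \<comment> \<open>On the inner ball the barrier is at most \<open>m\<close>. For
    \<open>m = 0\<close> it vanishes identically and would not be strict. Both cases are settled
    directly.\<close>
  show ?thesis
  proof (cases "x \<in> cball y \<rho> \<or> m = 0")
    case True
    then show ?thesis using \<phi>m[of x] m(2)[of x] pos[of x] S x by (auto simp: \<phi>_def)
  next
    case False
    then have m0: "m > 0" using m by auto
    let ?K = "cball y \<sigma> - ball y \<rho>" and ?U = "ball y \<sigma> - cball y \<rho>"
    have "\<phi> x \<le> u x"
    proof (rule visc_comparison[OF u _ lL(2), where K = ?K and U = ?U])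
      show "compact ?K" by (intro compact_diff) auto
      show "open ?U" by (intro open_Diff) auto
      show "continuous_on ?K \<phi>" unfolding \<phi>_def by (intro continuous_intros)
      show "continuous_on ?K u" using S by (intro continuous_on_subset[OF cont]) auto
    next
      fix z assume "z \<in> ?K - ?U"
      then consider "norm (z - y) = \<sigma>" | "z \<in> cball y \<rho>" by (auto simp: dist_norm norm_minus_commute)
      then show "\<phi> z \<le> u z"
      proof cases
        case 1
        then have "z \<in> S" using S by (auto simp: dist_norm norm_minus_commute)
        then show ?thesis using pos 1 by (simp add: \<phi>_def)
      qed (use \<phi>m[of z] m(2)[of z] in simp)
    next
      fix z assume z: "z \<in> ?U"
      define s where "s = (z - y) \<bullet> (z - y)"
      have "\<rho> \<le> norm (z - y)" using z by (auto simp: dist_norm norm_minus_commute)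
      then have s: "\<rho>\<^sup>2 \<le> s" using \<rho> by (simp add: s_def power_mono flip: power2_norm_eq_inner)
      define F where "F s = m * (exp (- t * s) - exp (- t * \<sigma>\<^sup>2))" for s
      define F' where "F' s = - (m * t * exp (- t * s))" for s
      define F2 where "F2 = m * t\<^sup>2 * exp (- t * s)"
      define H where "H h = F' s *\<^sub>R (2 *\<^sub>R h) + (F2 * ((2 *\<^sub>R (z - y)) \<bullet> h)) *\<^sub>R (2 *\<^sub>R (z - y))" for h
      have "twice_diff (\<lambda>x. F ((x - y) \<bullet> (x - y))) z (F' s *\<^sub>R (2 *\<^sub>R (z - y))) H"
        unfolding s_def H_def
        by (intro twice_diff_compose twice_diff_norm_sq always_eventually allI)
           (auto simp: F_def F'_def F2_def s_def power2_eq_square intro!: derivative_eq_intros)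
      then have td: "twice_diff \<phi> z (F' s *\<^sub>R (2 *\<^sub>R (z - y))) H"
        unfolding F_def \<phi>_def power2_norm_eq_inner .
      define E where "E = m * t * exp (- t * s)"
      have E: "E > 0" using m0 t0 by (simp add: E_def)
      have HE: "h \<bullet> H h = E * (4 * t * ((z - y) \<bullet> h)\<^sup>2 + - (2 * (h \<bullet> h)))" for h
        by (simp add: H_def F'_def F2_def E_def inner_add_right inner_commute power2_eq_square algebra_simps)
      have "pucci_ge l L (\<lambda>h. h \<bullet> H h) (E * (4 * t * (l * s) + - (L * 2 * real CARD('n))))"
        unfolding HE s_def using E t0 lL
        by (intro pucci_ge_add pucci_ge_cmult pucci_ge_inner_sq pucci_ge_neg_norm_sq) auto
      moreover have "4 * t * (l * s) + - (L * 2 * real CARD('n)) > 0"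
      proof -
        have "2 * (L * real CARD('n)) < 4 * t * l * \<rho>\<^sup>2" using \<rho> lL n by (simp add: t)
        also have "\<dots> \<le> 4 * t * l * s" using s t0 lL by (intro mult_left_mono) auto
        finally show ?thesis by (simp add: algebra_simps)
      qed
      then have "E * (4 * t * (l * s) + - (L * 2 * real CARD('n))) > 0" using E by simp
      moreover have "f z \<ge> 0" using z S f[of z] by (auto simp: subset_iff)
      ultimately show "\<exists>g H B. twice_diff \<phi> z g H \<and> pucci_ge l L (\<lambda>h. h \<bullet> H h) B \<and> B + f z > 0"
        using td by (meson add_pos_nonneg)
    qed (use S x False lL in auto)
    then show ?thesis by (simp add: \<phi>_def)
  qed
qed

text \<open>The downward paraboloid from height \<open>u x\<close> reaches zero on the sphere of
  radius \<open>\<rho>\<close>, so \<open>u - \<phi>\<close> attains its least value over the closed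
  ball at an interior point, where the equation bounds \<open>f\<close>.\<close>

lemma paraboloid_estimate:
  fixes u :: "real^'n \<Rightarrow> real"
  assumes u: "visc_supersol l L S u f" and lL: "0 < l" "l \<le> L"
    and cont: "continuous_on S u" and pos: "\<And>x. x \<in> S \<Longrightarrow> 0 \<le> u x"
    and S: "cball x \<rho> \<subseteq> S" and \<rho>: "0 < \<rho>"
  obtains z where "z \<in> ball x \<rho>" "f z \<le> 2 * real CARD('n) * L * u x / \<rho>\<^sup>2"
proof -
  define a where "a = u x / \<rho>\<^sup>2"
  have a: "a \<ge> 0" using pos[of x] S \<rho> unfolding a_def by (intro divide_nonneg_nonneg) (auto simp: subset_iff)
  define \<phi> where "\<phi> y = u x + (- a) * ((y - x) \<bullet> (y - x))" for y
  have "continuous_on (cball x \<rho>) (\<lambda>y. u y - \<phi> y)"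
    unfolding \<phi>_def by (intro continuous_intros continuous_on_subset[OF cont S])
  then obtain z where z: "z \<in> cball x \<rho>" "\<And>y. y \<in> cball x \<rho> \<Longrightarrow> u z - \<phi> z \<le> u y - \<phi> y"
    using continuous_attains_inf[of "cball x \<rho>" "\<lambda>y. u y - \<phi> y"] \<rho> by auto
  \<comment> \<open>On the sphere \<open>u - \<phi>\<close> is nonnegative, while it is zero at the
    centre; a minimiser on the sphere can thus be replaced by \<open>x\<close>.\<close>
  obtain z' where z': "z' \<in> ball x \<rho>" "\<And>y. y \<in> cball x \<rho> \<Longrightarrow> u z' - \<phi> z' \<le> u y - \<phi> y"
  proof (cases "z \<in> ball x \<rho>")
    case False
    then have "norm (z - x) = \<rho>" using z(1) by (auto simp: dist_norm norm_minus_commute)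
    then have "\<phi> z = 0" using \<rho> by (simp add: \<phi>_def a_def flip: power2_norm_eq_inner)
    moreover have "u z \<ge> 0" using z(1) S pos by auto
    ultimately have "u x - \<phi> x \<le> u z - \<phi> z" by (simp add: \<phi>_def)
    then show thesis using z(2) \<rho> that[of x] by force
  qed (use z that in auto)
  obtain r where r: "r > 0" "ball z' r \<subseteq> ball x \<rho>" using z'(1) by (meson open_ball open_contains_ball)
  have "local_min_on S (\<lambda>y. u y - \<phi> y) z'"
    unfolding local_min_on_def
  proof (intro conjI exI[of _ r] ballI impI)
    fix y assume "dist y z' < r"
    then have "y \<in> cball x \<rho>" using r(2) by (auto simp: dist_commute subset_iff less_imp_le)
    then show "u z' - \<phi> z' \<le> u y - \<phi> y" by (rule z'(2))
  qed (use z'(1) S r(1) in auto)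
  moreover have "twice_diff \<phi> z' (0 + (- a) *\<^sub>R (2 *\<^sub>R (z' - x))) (\<lambda>h. 0 + (- a) *\<^sub>R (2 *\<^sub>R h))"
    unfolding \<phi>_def by (intro twice_diff_add twice_diff_const twice_diff_cmult twice_diff_norm_sq)
  moreover have "pucci_ge l L (\<lambda>h::real^'n. h \<bullet> (0 + (- a) *\<^sub>R (2 *\<^sub>R h))) (- (L * (2 * a) * real CARD('n)))"
    using pucci_ge_neg_norm_sq[of "2 * a" l L] a by (simp add: mult.left_commute mult.assoc)
  ultimately have "- (L * (2 * a) * real CARD('n)) + f z' \<le> 0"
    using visc_supersol_twice_diff[OF u] lL by (meson less_imp_le)
  then show thesis using z'(1) by (intro that) (auto simp: a_def field_simps)
qed

text \<open>The zero set is open: if \<open>u\<close> were positive at some \<open>y\<close> close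
  to a zero \<open>z\<close>, the Gaussian bound centred at \<open>y\<close> would be positive at
  \<open>z\<close>. Connectedness does the rest.\<close>

lemma strong_minimum_principle:
  fixes u :: "real^'n \<Rightarrow> real"
  assumes u: "visc_supersol l L S u f" and lL: "0 < l" "l \<le> L"
    and f: "\<And>x. x \<in> S \<Longrightarrow> 0 \<le> f x" and cont: "continuous_on S u" and pos: "\<And>x. x \<in> S \<Longrightarrow> 0 \<le> u x"
    and S: "open S" "connected S" and x: "x \<in> S" "u x \<noteq> 0"
    and y: "y \<in> S"
  shows "0 < u y"
proof -
  define Z where "Z = {x \<in> S. u x = 0}"
  define P where "P = {x \<in> S. u x > 0}"
  have "P = S \<inter> u -` {0<..}" by (auto simp: P_def)
  then have "open P" using continuous_open_preimage[OF cont S(1) open_greaterThan] by simp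
  moreover have "open Z"
    unfolding open_contains_ball
  proof
    fix z assume "z \<in> Z"
    then have z: "z \<in> S" "u z = 0" by (auto simp: Z_def)
    \<comment> \<open>Room for the ball of radius \<open>2 r\<close> about any \<open>y\<close>
      within \<open>r\<close> of \<open>z\<close>; it has \<open>z\<close> in its interior, where
      the barrier is positive.\<close>
    obtain r where r: "r > 0" "ball z (4 * r) \<subseteq> S"
    proof -
      obtain r where "r > 0" "ball z r \<subseteq> S" using S(1) z by (auto simp: open_contains_ball)
      then show thesis using that[of "r / 4"] by auto
    qed
    have "u y = 0" if yz: "dist z y < r" for y
    proof (rule ccontr)
      assume "u y \<noteq> 0"
      have sub: "cball y (2 * r) \<subseteq> S"
      proof
        fix a assume "a \<in> cball y (2 * r)"
        then have "dist z a < 4 * r" using yz r(1) dist_triangle[of z a y] by simp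
        then show "a \<in> S" using r(2) by auto
      qed
      then have "y \<in> S" using r by auto
      then have uy: "u y > 0" using \<open>u y \<noteq> 0\<close> pos[of y] by auto
      have "isCont u y" using cont S(1) \<open>y \<in> S\<close> continuous_on_eq_continuous_at by blast
      then obtain d where d: "d > 0" "\<And>a. dist a y < d \<Longrightarrow> dist (u a) (u y) < u y / 2"
        using uy unfolding continuous_at_eps_delta by (meson half_gt_zero)
      define \<rho> where "\<rho> = min (d / 2) r"
      define t where "t = real CARD('n) * L / (l * \<rho>\<^sup>2)"
      have \<rho>: "0 < \<rho>" "\<rho> < 2 * r" using d r by (auto simp: \<rho>_def)
      have t: "t > 0" using lL \<rho> by (auto simp: t_def)
      have "u y / 2 \<le> u a" if "a \<in> cball y \<rho>" for a
      proof -
        have "dist a y < d" using that d(1) by (auto simp: \<rho>_def dist_commute)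
        then show ?thesis using d(2)[of a] unfolding dist_real_def by linarith
      qed
      then have "u y / 2 * (exp (- t * (norm (z - y))\<^sup>2) - exp (- t * (2 * r)\<^sup>2)) \<le> u z"
        using uy yz r(1)
        by (intro gaussian_lower_bound[OF u lL f cont pos sub \<rho> _ _ _ t_def]) (auto simp: dist_commute)
      moreover have "(norm (z - y))\<^sup>2 < (2 * r)\<^sup>2"
        using yz r(1) by (intro power_strict_mono) (auto simp: dist_norm)
      then have "exp (- t * (norm (z - y))\<^sup>2) - exp (- t * (2 * r)\<^sup>2) > 0" using t by simp
      ultimately show False using z uy by (simp add: mult_le_0_iff not_less)
    qed
    moreover have "ball z r \<subseteq> S" using r by (auto simp: subset_iff)
    ultimately show "\<exists>e>0. ball z e \<subseteq> Z" using r(1) by (auto simp: Z_def intro!: exI[of _ r])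
  qed
  moreover have SZP: "S \<subseteq> Z \<union> P" using pos by (force simp: Z_def P_def)
  moreover have "Z \<inter> P \<inter> S = {}" by (auto simp: Z_def P_def)
  ultimately have "Z \<inter> S = {} \<or> P \<inter> S = {}" using connectedD[OF S(2)] by metis
  moreover have "x \<in> P \<inter> S" using x pos[of x] by (auto simp: P_def)
  ultimately have "Z \<inter> S = {}" by auto
  then have "y \<in> P" using y SZP by blast
  then show ?thesis by (simp add: P_def)
qed

subsection \<open>Explicit subsolutions in the half-space\<close>

lemma frame_sum_inner:
  assumes "frame w"
  shows "(\<Sum>i\<in>UNIV. (v \<bullet> w i) * (v' \<bullet> w i)) = v \<bullet> v'"
proof -
  have "(\<Sum>i\<in>UNIV. ((v + v') \<bullet> w i)\<^sup>2) =
      (\<Sum>i\<in>UNIV. (v \<bullet> w i)\<^sup>2) + 2 * (\<Sum>i\<in>UNIV. (v \<bullet> w i) * (v' \<bullet> w i)) + (\<Sum>i\<in>UNIV. (v' \<bullet> w i)\<^sup>2)"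
    unfolding sum_distrib_left sum.distrib[symmetric]
    by (intro sum.cong) (simp_all add: inner_add_left power2_eq_square algebra_simps)
  then show ?thesis
    unfolding frame_sum_inner_sq[OF assms] by (simp add: inner_add_left inner_add_right inner_commute)
qed

lemma twice_diff_ln:
  assumes "twice_diff f x g H" "f x > 0"
  shows "twice_diff (\<lambda>y. ln (f y)) x ((1 / f x) *\<^sub>R g) (\<lambda>h. (1 / f x) *\<^sub>R H h + (- (1 / (f x)\<^sup>2) * (g \<bullet> h)) *\<^sub>R g)"
proof (rule twice_diff_compose[OF assms(1), where F' = "\<lambda>s. 1 / s"])
  have "\<forall>\<^sub>F s in nhds (f x). s > 0" using assms(2) by (rule eventually_nhds_in_open[OF open_greaterThan, unfolded greaterThan_iff])
  then show "\<forall>\<^sub>F s in nhds (f x). (ln has_real_derivative 1 / s) (at s)"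
    by eventually_elim (auto intro!: derivative_eq_intros)
  show "((\<lambda>s. 1 / s) has_real_derivative - (1 / (f x)\<^sup>2)) (at (f x))"
    using assms(2) by (auto intro!: derivative_eq_intros simp: power2_eq_square)
qed

lemma twice_diff_exp:
  assumes "twice_diff f x g H"
  shows "twice_diff (\<lambda>y. exp (f y)) x (exp (f x) *\<^sub>R g) (\<lambda>h. exp (f x) *\<^sub>R H h + (exp (f x) * (g \<bullet> h)) *\<^sub>R g)"
  by (rule twice_diff_compose[OF assms]) (auto intro!: always_eventually derivative_eq_intros)

section \<open>Products of powers of the height and of the norm\<close>

text \<open>Homogeneous of degree \<open>a - b\<close>. Besides the main exponents,
  \<open>a = 2\<close> occurs, as the corrector in the critical case.\<close>

definition half_power :: "'n::finite \<Rightarrow> real \<Rightarrow> real \<Rightarrow> real^'n \<Rightarrow> real" where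
  "half_power k a b x = (x $ k) powr a * norm x powr (- b)"

text \<open>The Hessian form of \<open>half_power k a b\<close> at \<open>x\<close>, divided by its value there.\<close>

definition half_power_hess :: "'n::finite \<Rightarrow> real \<Rightarrow> real \<Rightarrow> real^'n \<Rightarrow> real^'n \<Rightarrow> real" where
  "half_power_hess k a b x h =
     (a * (h $ k) / x $ k - b * (x \<bullet> h) / (x \<bullet> x))\<^sup>2 - a * (h $ k)\<^sup>2 / (x $ k)\<^sup>2
     - b * (h \<bullet> h) / (x \<bullet> x) + 2 * b * (x \<bullet> h)\<^sup>2 / (x \<bullet> x)\<^sup>2"

text \<open>Computed through the logarithm, where the product becomes a sum: the Hessian form of
  \<open>exp g\<close> is \<open>exp g\<close> times the sum of that of \<open>g\<close> and the
  squared derivative of \<open>g\<close>. Hence the leading square in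
  \<open>half_power_hess\<close>.\<close>

lemma half_power_twice_diff:
  fixes x :: "real^'n"
  assumes x: "x $ k > 0"
  obtains H where
    "twice_diff (half_power k a b) x (half_power k a b x *\<^sub>R ((a / x $ k) *\<^sub>R axis k 1 - (b / (x \<bullet> x)) *\<^sub>R x)) H"
    "\<And>h. h \<bullet> H h = half_power k a b x * half_power_hess k a b x h"
proof -
  let ?e = "axis k 1 :: real^'n"
  have ev: "\<forall>\<^sub>F y in nhds x. y $ k > 0"
    using eventually_nhds_in_open[OF open_half_space[of k], of x] x by (simp add: half_space_def)
  \<comment> \<open>The terms \<open>- 0\<close> match the differentiation rules, which are stated
    for an arbitrary centre \<open>c\<close>.\<close>
  define lg where "lg y = a * ln (?e \<bullet> (y - 0)) + (- b / 2) * ln ((y - 0) \<bullet> (y - 0))" for y :: "real^'n"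
  have exp_eq: "exp (lg y) = half_power k a b y" if "y $ k > 0" for y
  proof -
    have "y \<noteq> 0" using that by auto
    moreover have "ln (y \<bullet> y) = 2 * ln (norm y)"
      using \<open>y \<noteq> 0\<close> by (simp add: norm_eq_sqrt_inner ln_sqrt)
    ultimately show ?thesis
      using that by (simp add: half_power_def lg_def powr_def inner_axis' mult_exp_exp)
  qed
  have pos: "?e \<bullet> (x - 0) > 0" "(x - 0) \<bullet> (x - 0) > 0" using x by (auto simp: inner_axis')
  define g where "g = a *\<^sub>R ((1 / (?e \<bullet> (x - 0))) *\<^sub>R ?e) + (- b / 2) *\<^sub>R ((1 / ((x - 0) \<bullet> (x - 0))) *\<^sub>R (2 *\<^sub>R (x - 0)))"
  define H where "H h = a *\<^sub>R ((1 / (?e \<bullet> (x - 0))) *\<^sub>R 0 + (- (1 / (?e \<bullet> (x - 0))\<^sup>2) * (?e \<bullet> h)) *\<^sub>R ?e) +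
      (- b / 2) *\<^sub>R ((1 / ((x - 0) \<bullet> (x - 0))) *\<^sub>R (2 *\<^sub>R h)
        + (- (1 / ((x - 0) \<bullet> (x - 0))\<^sup>2) * ((2 *\<^sub>R (x - 0)) \<bullet> h)) *\<^sub>R (2 *\<^sub>R (x - 0)))" for h
  have lg: "twice_diff lg x g H"
    unfolding lg_def g_def H_def
    by (intro twice_diff_add twice_diff_cmult twice_diff_ln twice_diff_inner twice_diff_norm_sq pos)
  define H' where "H' h = half_power k a b x *\<^sub>R H h + (half_power k a b x * (g \<bullet> h)) *\<^sub>R g" for h
  have td: "twice_diff (half_power k a b) x (half_power k a b x *\<^sub>R g) H'"
    using twice_diff_cong[OF twice_diff_exp[OF lg] eventually_mono[OF ev exp_eq]] x
    unfolding H'_def by (simp add: exp_eq)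
  have g: "g = (a / x $ k) *\<^sub>R ?e - (b / (x \<bullet> x)) *\<^sub>R x"
    by (simp add: g_def inner_axis')
  have H': "h \<bullet> H' h = half_power k a b x * half_power_hess k a b x h" for h
  proof -
    have gh: "g \<bullet> h = a * (h $ k) / x $ k - b * (x \<bullet> h) / (x \<bullet> x)"
      by (simp add: g inner_diff_left inner_axis')
    have "h \<bullet> H h = - (a * (h $ k)\<^sup>2 / (x $ k)\<^sup>2) - b * (h \<bullet> h) / (x \<bullet> x) + 2 * b * (x \<bullet> h)\<^sup>2 / (x \<bullet> x)\<^sup>2"
      by (simp add: H_def inner_add_right inner_diff_right inner_axis inner_axis' inner_commute
          power2_eq_square right_diff_distrib)
    then have "half_power_hess k a b x h = h \<bullet> H h + (g \<bullet> h)\<^sup>2"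
      by (simp add: half_power_hess_def gh)
    then show ?thesis
      by (simp add: H'_def inner_add_right inner_commute[of h g] power2_eq_square distrib_left)
  qed
  show thesis by (rule that[OF td[unfolded g] H'])
qed

text \<open>Puts \<open>axis k 1\<close> into the plane of \<open>x\<close> and a unit vector
  \<open>y\<close>, so that the Hessian reduces to a two by two block. If \<open>x\<close> is
  parallel to \<open>axis k 1\<close>, any orthogonal \<open>y\<close> works, and dimension at least
  two provides one.\<close>

lemma orthonormal_companion:
  fixes x :: "real^'n"
  assumes n: "CARD('n) \<ge> 2" and x: "x \<noteq> 0"
  obtains y \<sigma> where "y \<bullet> y = 1" "x \<bullet> y = 0" "axis k 1 = (x $ k / (x \<bullet> x)) *\<^sub>R x + \<sigma> *\<^sub>R y"
proof -
  define d where "d = axis k 1 - (x $ k / (x \<bullet> x)) *\<^sub>R x"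
  have dx: "x \<bullet> d = 0" using x by (simp add: d_def inner_diff_right inner_axis)
  show thesis
  proof (cases "d = 0")
    case True
    obtain y where "y \<noteq> 0" "orthogonal x y"
      using orthogonal_to_vector_exists[of x] n by (auto simp: orthogonal_commute)
    then show thesis using True
      by (intro that[of "(1 / norm y) *\<^sub>R y" 0]) (auto simp: d_def orthogonal_def norm_eq_sqrt_inner)
  next
    case False
    then show thesis using dx
      by (intro that[of "(1 / norm d) *\<^sub>R d" "norm d"])
         (auto simp: d_def[symmetric] norm_eq_sqrt_inner, simp add: d_def)
  qed
qed

text \<open>If \<open>A + m I\<close> is positive semidefinite and \<open>A11 \<ge> 0\<close>, then \<open>m\<close> times the projection onto the second column
  of the adjugate of \<open>A + m I\<close> already repairs \<open>A\<close>.\<close>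

lemma rank_one_correction_nonneg:
  fixes A11 A12 A22 m g :: real
  assumes g: "g = A11 + m" "g > 0" and A: "A11 \<ge> 0" and X: "g * (A22 + m) \<ge> A12\<^sup>2"
  shows "0 \<le> A11 * \<xi>\<^sup>2 + 2 * A12 * \<xi> * \<eta> + A22 * \<eta>\<^sup>2 + m / (A12\<^sup>2 + g\<^sup>2) * (g * \<eta> - A12 * \<xi>)\<^sup>2"
    (is "0 \<le> ?e")
proof -
  define D where "D = A12\<^sup>2 + g\<^sup>2"
  have D: "D > 0" using g by (simp add: D_def add_nonneg_pos)
  have m: "m = g - A11" using g by simp
  \<comment> \<open>After multiplication by \<open>g D\<close> the form becomes a sum of two squares
    with nonnegative coefficients; the first is the square of the first row of
    \<open>A + m I\<close>.\<close>
  have "(g * D) * ?e = g * (D * (A11 * \<xi>\<^sup>2 + 2 * A12 * \<xi> * \<eta> + A22 * \<eta>\<^sup>2) + m * (g * \<eta> - A12 * \<xi>)\<^sup>2)"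
    using D by (simp add: D_def[symmetric] algebra_simps)
  also have "\<dots> = (g * A11 + A12\<^sup>2) * (g * \<xi> + A12 * \<eta>)\<^sup>2 + D * (g * (A22 + m) - A12\<^sup>2) * \<eta>\<^sup>2"
    unfolding D_def m by algebra
  also have "\<dots> \<ge> 0"
    using D g(2) A X by (intro add_nonneg_nonneg mult_nonneg_nonneg) auto
  finally have "0 \<le> (g * D) * ?e" .
  moreover have "0 < g * D" using D g(2) by simp
  ultimately show ?thesis by (meson zero_le_mult_iff not_le)
qed

text \<open>In the plane spanned by \<open>x\<close> and \<open>axis k 1\<close> the Hessian form has one negative eigenvalue, at least \<open>- m\<close>;
  the exponents make the trace equal to \<open>(R - 1)\<close> times the trace of the correction \<open>P\<close>.\<close>

lemma half_power_subsolution: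
  fixes x :: "real^'n"
  assumes n: "CARD('n) \<ge> 2" and lL: "0 < l" "l \<le> L" and x: "x $ k > 0"
  shows "pucci_ge l L (half_power_hess k (L / l) (L / l * (real CARD('n) + 1) - 1) x) 0"
proof -
  define R where "R = L / l"
  define N where "N = real CARD('n)"
  define al where "al = R * N - 1"
  define b where "b = R * (N + 1) - 1"
  have R: "R \<ge> 1" using lL by (simp add: R_def)
  have N: "N \<ge> 2" using n by (simp add: N_def)
  have RN: "R * N \<ge> 2" using mult_mono[of 1 R 2 N] R N by simp
  have "x \<noteq> 0" using x by auto
  then obtain y \<sigma> where y: "y \<bullet> y = 1" "x \<bullet> y = 0" "axis k 1 = (x $ k / (x \<bullet> x)) *\<^sub>R x + \<sigma> *\<^sub>R y"
    using orthonormal_companion[OF n] by blast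
  define r where "r = norm x"
  have r: "r > 0" "x \<bullet> x = r\<^sup>2" using \<open>x \<noteq> 0\<close> by (auto simp: r_def power2_norm_eq_inner)
  \<comment> \<open>The signed tangent of the angle between \<open>axis k 1\<close> and
    \<open>x\<close>: in the basis \<open>x / r\<close>, \<open>y\<close> the vector
    \<open>axis k 1\<close> is proportional to \<open>(1, t)\<close>.\<close>
  define t where "t = \<sigma> * r / x $ k"
  define \<xi> where "\<xi> h = (x \<bullet> h) / r" for h
  define \<eta> where "\<eta> h = y \<bullet> h" for h
  have hk: "h $ k / x $ k = (\<xi> h + t * \<eta> h) / r" for h
  proof -
    have "h $ k = axis k 1 \<bullet> h" by (simp add: inner_axis')
    also have "\<dots> = x $ k / r\<^sup>2 * (x \<bullet> h) + \<sigma> * (y \<bullet> h)" by (simp add: y(3) r inner_add_left)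
    finally show ?thesis using x r by (simp add: \<xi>_def \<eta>_def t_def field_simps power2_eq_square)
  qed
  \<comment> \<open>Entries of \<open>r^2\<close> times the form in the coordinates
    \<open>\<xi>\<close>, \<open>\<eta>\<close>; orthogonally to the plane the form is
    \<open>- b\<close> times the identity. \<open>A11\<close> is the radial factor of a function of
    degree \<open>- al\<close>.\<close>
  define A11 where "A11 = al * (al + 1)"
  define A12 where "A12 = - (R * (al + 1) * t)"
  define A22 where "A22 = R * (R - 1) * t\<^sup>2 - b"
  \<comment> \<open>For \<open>R > 1\<close> this is the only value satisfying the trace identity
    \<open>trA\<close>; \<open>X\<close> then confirms that \<open>A + m I\<close> is positive
    semidefinite.\<close>
  define m where "m = R * (N + 2) - 1 + R * t\<^sup>2"
  define g where "g = A11 + m"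
  define D where "D = A12\<^sup>2 + g\<^sup>2"
  define q where "q h = A11 * (\<xi> h)\<^sup>2 + 2 * A12 * \<xi> h * \<eta> h + A22 * (\<eta> h)\<^sup>2" for h
  define P where "P h = b * (h \<bullet> h - (\<xi> h)\<^sup>2 - (\<eta> h)\<^sup>2) + m / D * (g * \<eta> h - A12 * \<xi> h)\<^sup>2" for h
  define Q where "Q h = q h - b * (h \<bullet> h - (\<xi> h)\<^sup>2 - (\<eta> h)\<^sup>2)" for h
  have hess: "half_power_hess k R b x = (\<lambda>h. (1 / r\<^sup>2) * Q h)"
  proof
    fix h
    have "half_power_hess k R b x h = (R * (h $ k / x $ k) - b * \<xi> h / r)\<^sup>2 - R * (h $ k / x $ k)\<^sup>2
        - b * (h \<bullet> h) / r\<^sup>2 + 2 * b * (\<xi> h / r)\<^sup>2"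
      using r by (simp add: half_power_hess_def \<xi>_def power2_eq_square)
    also have "\<dots> = (1 / r\<^sup>2) * ((R * (\<xi> h + t * \<eta> h) - b * \<xi> h)\<^sup>2 - R * (\<xi> h + t * \<eta> h)\<^sup>2
        - b * (h \<bullet> h) + 2 * b * (\<xi> h)\<^sup>2)"
      unfolding hk using r by (simp add: field_simps power2_eq_square)
    also have "(R * (\<xi> h + t * \<eta> h) - b * \<xi> h)\<^sup>2 - R * (\<xi> h + t * \<eta> h)\<^sup>2
        - b * (h \<bullet> h) + 2 * b * (\<xi> h)\<^sup>2 = Q h"
      unfolding Q_def q_def A11_def A12_def A22_def al_def b_def by algebra
    finally show "half_power_hess k R b x h = (1 / r\<^sup>2) * Q h" .
  qed
  have b0: "b \<ge> 0" using R N RN by (simp add: b_def algebra_simps)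
  have m0: "m > 0"
  proof -
    have "R * t\<^sup>2 \<ge> 0" using R by simp
    then have "R * N + 2 * R - 1 + R * t\<^sup>2 > 0" using R RN by linarith
    then show ?thesis by (simp add: m_def algebra_simps)
  qed
  have A0: "A11 \<ge> 0" using RN by (simp add: A11_def al_def)
  have g0: "g > 0" using A0 m0 by (simp add: g_def)
  have D0: "D > 0" using g0 by (simp add: D_def add_nonneg_pos)
  have X: "g * (A22 + m) \<ge> A12\<^sup>2"
  proof -
    have "g * (A22 + m) - A12\<^sup>2 = R * ((R * N)\<^sup>2 + (2 * R - 1) + 2 * R\<^sup>2 * t\<^sup>2 + R\<^sup>2 * (t\<^sup>2)\<^sup>2)"
      unfolding g_def A22_def A11_def A12_def m_def b_def al_def by algebra
    also have "\<dots> \<ge> 0" using R by (intro mult_nonneg_nonneg add_nonneg_nonneg) auto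
    finally show ?thesis by simp
  qed
  have bessel: "h \<bullet> h - (\<xi> h)\<^sup>2 - (\<eta> h)\<^sup>2 \<ge> 0" for h
  proof -
    have exp: "(h - c *\<^sub>R x - d *\<^sub>R y) \<bullet> (h - c *\<^sub>R x - d *\<^sub>R y) =
        h \<bullet> h - 2 * c * (x \<bullet> h) - 2 * d * (y \<bullet> h) + c\<^sup>2 * (x \<bullet> x) + 2 * c * d * (x \<bullet> y) + d\<^sup>2 * (y \<bullet> y)" for c d
      by (simp add: inner_diff_left inner_diff_right inner_commute power2_eq_square algebra_simps)
    define z where "z = h - (\<xi> h / r) *\<^sub>R x - \<eta> h *\<^sub>R y"
    have "z \<bullet> z = h \<bullet> h - (\<xi> h)\<^sup>2 - (\<eta> h)\<^sup>2"
      using r unfolding z_def exp y(1,2)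
      by (simp add: \<xi>_def \<eta>_def power2_eq_square field_simps)
    then show ?thesis using inner_ge_zero[of z] by simp
  qed
  have trA: "A11 + A22 - b * (N - 2) - (R - 1) * (b * (N - 2) + m) = 0"
    unfolding A22_def A11_def m_def b_def al_def by algebra
  have "pucci_ge l L Q (l * (A11 + A22 - b * (N - 2)) - (L - l) * (b * (N - 2) + m))"
  proof (rule pucci_ge_split[of P])
    fix h
    show "0 \<le> P h"
      unfolding P_def using b0 m0 D0 bessel[of h] by simp
    show "0 \<le> Q h + P h"
      using rank_one_correction_nonneg[OF g_def g0 A0 X, of "\<xi> h" "\<eta> h"]
      by (simp add: P_def Q_def q_def D_def)
  next
    fix w :: "'n \<Rightarrow> real^'n" assume w: "frame w"
    have S: "(\<Sum>i\<in>UNIV. (\<xi> (w i))\<^sup>2) = 1" "(\<Sum>i\<in>UNIV. (\<eta> (w i))\<^sup>2) = 1" "(\<Sum>i\<in>UNIV. \<xi> (w i) * \<eta> (w i)) = 0"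
      "(\<Sum>i\<in>UNIV. w i \<bullet> w i) = N"
      using frame_sum_inner_sq[OF w, of x] frame_sum_inner_sq[OF w, of y] frame_sum_inner[OF w, of x y] y r
      by (simp_all add: \<xi>_def \<eta>_def power_divide frame_inner_self[OF w] N_def flip: sum_divide_distrib)
    have Sb: "(\<Sum>i\<in>UNIV. b * (w i \<bullet> w i - (\<xi> (w i))\<^sup>2 - (\<eta> (w i))\<^sup>2)) = b * (N - 2)"
      by (simp add: sum_subtractf S flip: sum_distrib_left)
    have "(\<Sum>i\<in>UNIV. q (w i)) = A11 * (\<Sum>i\<in>UNIV. (\<xi> (w i))\<^sup>2) + 2 * A12 * (\<Sum>i\<in>UNIV. \<xi> (w i) * \<eta> (w i))
        + A22 * (\<Sum>i\<in>UNIV. (\<eta> (w i))\<^sup>2)"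
      by (simp add: q_def sum.distrib sum_distrib_left mult.assoc)
    then show "(\<Sum>i\<in>UNIV. Q (w i)) = A11 + A22 - b * (N - 2)"
      by (simp add: Q_def sum_subtractf Sb S)
    have "(\<Sum>i\<in>UNIV. (g * \<eta> (w i) - A12 * \<xi> (w i))\<^sup>2) = g\<^sup>2 * (\<Sum>i\<in>UNIV. (\<eta> (w i))\<^sup>2)
        - 2 * g * A12 * (\<Sum>i\<in>UNIV. \<xi> (w i) * \<eta> (w i)) + A12\<^sup>2 * (\<Sum>i\<in>UNIV. (\<xi> (w i))\<^sup>2)"
      unfolding sum_distrib_left sum_subtractf[symmetric] sum.distrib[symmetric]
      by (intro sum.cong) (auto simp: power2_eq_square algebra_simps)
    then have "(\<Sum>i\<in>UNIV. (g * \<eta> (w i) - A12 * \<xi> (w i))\<^sup>2) = D"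
      by (simp add: S D_def)
    then have "(\<Sum>i\<in>UNIV. m / D * (g * \<eta> (w i) - A12 * \<xi> (w i))\<^sup>2) = m"
      using D0 unfolding sum_distrib_left[symmetric] by simp
    then show "(\<Sum>i\<in>UNIV. P (w i)) = b * (N - 2) + m"
      unfolding P_def sum.distrib Sb by simp
  qed
  moreover have "l * (A11 + A22 - b * (N - 2)) - (L - l) * (b * (N - 2) + m) = 0"
  proof -
    have "L = R * l" using lL by (simp add: R_def)
    then have "l * (A11 + A22 - b * (N - 2)) - (L - l) * (b * (N - 2) + m) =
        l * (A11 + A22 - b * (N - 2) - (R - 1) * (b * (N - 2) + m))" by (simp add: algebra_simps)
    then show ?thesis unfolding trA by simp
  qed
  ultimately have "pucci_ge l L Q 0" by simp
  from pucci_ge_cmult[OF this, of "1 / r\<^sup>2"]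
  have "pucci_ge l L (half_power_hess k R b x) 0" by (simp add: hess)
  then show ?thesis by (simp add: b_def N_def R_def)
qed

text \<open>The shift by \<open>axis k 1\<close> keeps the region inside the open half-space, where \<open>u\<close> is continuous and positive
  up to the boundary of the region.\<close>

lemma exterior_comparison:
  fixes u \<phi> :: "real^'n \<Rightarrow> real" and k :: 'n
  assumes u: "visc_supersol l L (half_space k) u f" and lL: "0 \<le> l" "l \<le> L"
    and cont: "continuous_on (half_space k) u" "continuous_on {y. 0 \<le> y $ k \<and> 1 \<le> norm y} \<phi>"
    and pos: "\<And>x. x \<in> half_space k \<Longrightarrow> 0 \<le> u x"
    and flat: "\<And>y. y $ k = 0 \<Longrightarrow> 1 \<le> norm y \<Longrightarrow> \<phi> y \<le> 0"
    and sph: "\<And>y. 0 \<le> y $ k \<Longrightarrow> norm y = 1 \<Longrightarrow> \<phi> y \<le> u (y + axis k 1)"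
    and decay: "(d \<longlongrightarrow> 0) at_top" "\<And>y. 0 \<le> y $ k \<Longrightarrow> 1 \<le> norm y \<Longrightarrow> \<phi> y \<le> d (norm y)"
    and sub: "\<And>y. 0 < y $ k \<Longrightarrow> 1 < norm y \<Longrightarrow>
      \<exists>g H B. twice_diff \<phi> y g H \<and> pucci_ge l L (\<lambda>h. h \<bullet> H h) B \<and> B + f (y + axis k 1) > 0"
    and y: "0 \<le> y $ k" "1 \<le> norm y"
  shows "\<phi> y \<le> u (y + axis k 1)"
proof (rule field_le_epsilon)
  fix e :: real assume e: "e > 0"
  then have "\<forall>\<^sub>F r in at_top. d r < e" using decay(1) by (rule order_tendstoD(2)[rotated])
  then obtain \<rho>0 where \<rho>0: "\<And>r. r \<ge> \<rho>0 \<Longrightarrow> d r < e" by (auto simp: eventually_at_top_linorder)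
  \<comment> \<open>The region is unbounded, so it is cut off at a sphere that encloses
    \<open>y\<close> and on which \<open>\<phi> < e\<close>. Subtracting \<open>e\<close> gives the
    inequality there, and \<open>e\<close> is arbitrary.\<close>
  define \<rho> where "\<rho> = max \<rho>0 (norm y)"
  define c where "c = (axis k 1 :: real^'n)"
  define K where "K = {x. c \<bullet> (x - c) \<ge> 0} \<inter> (cball c \<rho> - ball c 1)"
  define U where "U = {x. c \<bullet> (x - c) > 0} \<inter> (ball c \<rho> - cball c 1)"
  have ck: "c \<bullet> z = z $ k" "c $ k = 1" for z by (simp_all add: c_def inner_axis')
  have K: "x \<in> K \<longleftrightarrow> 0 \<le> (x - c) $ k \<and> 1 \<le> norm (x - c) \<and> norm (x - c) \<le> \<rho>" for x
    by (auto simp: K_def ck dist_norm norm_minus_commute)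
  have U: "x \<in> U \<longleftrightarrow> 0 < (x - c) $ k \<and> 1 < norm (x - c) \<and> norm (x - c) < \<rho>" for x
    by (auto simp: U_def ck dist_norm norm_minus_commute)
  have KS: "K \<subseteq> half_space k" by (auto simp: K half_space_def ck)
  have "\<phi> (y + c - c) + - e \<le> u (y + c)"
  proof (rule visc_comparison[OF u lL, where K = K and U = U and \<phi> = "\<lambda>x. \<phi> (x - c) + - e"])
    have "closed {x. c \<bullet> (x - c) \<ge> 0}" by (intro closed_Collect_le continuous_intros)
    then show "compact K" unfolding K_def by (intro closed_Int_compact compact_diff) auto
    have "open {x. c \<bullet> (x - c) > 0}" by (intro open_Collect_less continuous_intros)
    then show "open U" unfolding U_def by (intro open_Int open_Diff) auto
    show "U \<subseteq> K" by (auto simp: K U)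
    show "continuous_on K u" using cont(1) KS by (rule continuous_on_subset)
    have "continuous_on K (\<lambda>x. \<phi> (x - c))"
      by (rule continuous_on_compose2[OF cont(2)]) (auto simp: K intro!: continuous_intros)
    then show "continuous_on K (\<lambda>x. \<phi> (x - c) + - e)" by (intro continuous_intros)
  next
    fix x assume x: "x \<in> K - U"
    then have "0 \<le> u x" using KS pos by auto
    have x': "0 \<le> (x - c) $ k" "1 \<le> norm (x - c)" using x by (auto simp: K)
    from x consider "(x - c) $ k = 0" | "norm (x - c) = 1" | "norm (x - c) = \<rho>" by (force simp: K U)
    then show "\<phi> (x - c) + - e \<le> u x"
    proof cases
      case 1
      then show ?thesis using flat[of "x - c"] x' e \<open>0 \<le> u x\<close> by simp
    next
      case 2
      then show ?thesis using sph[of "x - c"] x' e by (simp add: c_def)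
    next
      case 3
      then have "d (norm (x - c)) < e" using \<rho>0[of \<rho>] by (simp add: \<rho>_def)
      then show ?thesis using decay(2)[of "x - c"] x' \<open>0 \<le> u x\<close> by linarith
    qed
  next
    fix x assume "x \<in> U"
    then obtain g H B where *: "twice_diff \<phi> (x - c) g H" "pucci_ge l L (\<lambda>h. h \<bullet> H h) B" "B + f x > 0"
      using sub[of "x - c"] by (auto simp: U c_def)
    have "twice_diff (\<lambda>x. \<phi> (x - c) + - e) x (g + 0) (\<lambda>h. H h + 0)"
      by (intro twice_diff_add twice_diff_const twice_diff_shift *(1))
    then show "\<exists>g H B. twice_diff (\<lambda>x. \<phi> (x - c) + - e) x g H \<and> pucci_ge l L (\<lambda>h. h \<bullet> H h) B \<and> 0 < B + f x"
      using *(2,3) by (metis (no_types, lifting) add.right_neutral ext)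
  qed (use KS y in \<open>auto simp: K \<rho>_def\<close>)
  then show "\<phi> y \<le> u (y + axis k 1) + e" by (simp add: c_def)
qed

section \<open>Lower bound by the homogeneous subsolution\<close>

lemma half_power_continuous:
  assumes "a > 0"
  shows "continuous_on {y. 0 \<le> y $ k \<and> 1 \<le> norm y} (half_power k a b)"
  unfolding half_power_def using assms
  by (intro continuous_on_mult continuous_on_powr' continuous_intros) auto

lemma half_power_eq_0: "y $ k = 0 \<Longrightarrow> half_power k a b y = 0"
  by (simp add: half_power_def)

lemma half_power_nonneg: "0 \<le> half_power k a b y"
  by (simp add: half_power_def)

lemma half_power_le:
  assumes "0 \<le> y $ k" "1 \<le> norm y" "0 \<le> a"
  shows "half_power k a b y \<le> norm y powr (a - b)"
proof -
  have "(y $ k) powr a \<le> norm y powr a"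
    using assms component_le_norm_cart[of y k] by (intro powr_mono2) auto
  then have "half_power k a b y \<le> norm y powr a * norm y powr (- b)"
    unfolding half_power_def by (intro mult_right_mono) auto
  then show ?thesis by (simp add: powr_add[symmetric])
qed

lemma positive_on_half_sphere:
  fixes u :: "real^'n \<Rightarrow> real"
  assumes "continuous_on (half_space k) u" "\<And>x. x \<in> half_space k \<Longrightarrow> 0 < u x"
  obtains c where "c > 0" "\<And>y. 0 \<le> y $ k \<Longrightarrow> norm y = 1 \<Longrightarrow> c \<le> u (y + axis k 1)"
proof -
  define K where "K = {y :: real^'n. 0 \<le> axis k 1 \<bullet> y} \<inter> sphere 0 1"
  have "closed {y :: real^'n. 0 \<le> axis k 1 \<bullet> y}" by (intro closed_Collect_le continuous_intros)
  then have "compact K" unfolding K_def by (intro closed_Int_compact) auto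
  moreover have "axis k 1 \<in> K" by (simp add: K_def)
  moreover have cont: "continuous_on K (\<lambda>y. u (y + axis k 1))"
    by (rule continuous_on_compose2[OF assms(1)])
       (auto simp: K_def half_space_def inner_axis' intro!: continuous_intros)
  ultimately obtain z where z: "z \<in> K" "\<forall>y\<in>K. u (z + axis k 1) \<le> u (y + axis k 1)"
    using continuous_attains_inf[OF _ _ cont] by blast
  show thesis
  proof (rule that)
    show "u (z + axis k 1) > 0" using z(1) by (intro assms(2)) (auto simp: K_def half_space_def inner_axis')
    show "u (z + axis k 1) \<le> u (y + axis k 1)" if "0 \<le> y $ k" "norm y = 1" for y
      using z(2) that by (auto simp: K_def inner_axis')
  qed
qed

text \<open>\<open>half_power\<close> is only a weak subsolution; the strictness that comparison
  demands comes from \<open>f > 0\<close>. On the unit half-sphere \<open>half_power\<close> is at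
  most \<open>1\<close>, so a lower bound of the shifted \<open>u\<close> there serves as
  \<open>c\<close>.\<close>

lemma half_power_lower_bound:
  fixes u :: "real^'n \<Rightarrow> real"
  assumes n: "CARD('n) \<ge> 2" and lL: "0 < l" "l \<le> L"
    and u: "visc_supersol l L (half_space k) u f" and cont: "continuous_on (half_space k) u"
    and pos: "\<And>x. x \<in> half_space k \<Longrightarrow> 0 < u x" "\<And>x. x \<in> half_space k \<Longrightarrow> 0 < f x"
  obtains c where "c > 0" "\<And>y. 0 \<le> y $ k \<Longrightarrow> 1 \<le> norm y \<Longrightarrow>
    c * half_power k (L / l) (L / l * (real CARD('n) + 1) - 1) y \<le> u (y + axis k 1)"
proof -
  define R where "R = L / l"
  define b where "b = R * (real CARD('n) + 1) - 1"
  have R: "R \<ge> 1" using lL by (simp add: R_def)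
  have RN: "R * real CARD('n) \<ge> 2" using mult_mono[of 1 R 2 "real CARD('n)"] R n by simp
  then have Rb: "R - b < 0" by (simp add: b_def algebra_simps)
  obtain c where c: "c > 0" "\<And>y. 0 \<le> y $ k \<Longrightarrow> norm y = 1 \<Longrightarrow> c \<le> u (y + axis k 1)"
    using positive_on_half_sphere[OF cont pos(1)] by blast
  show thesis
  proof (rule that[OF c(1)], fold R_def, fold b_def)
    fix y :: "real^'n" assume y: "0 \<le> y $ k" "1 \<le> norm y"
    show "c * half_power k R b y \<le> u (y + axis k 1)"
    proof (rule exterior_comparison[OF u _ lL(2) cont, where \<phi> = "\<lambda>y. c * half_power k R b y" and d = "\<lambda>r. c * r powr (R - b)"])
      show "continuous_on {y. 0 \<le> y $ k \<and> 1 \<le> norm y} (\<lambda>y. c * half_power k R b y)"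
        using R by (intro continuous_intros half_power_continuous) auto
      show "((\<lambda>r. c * r powr (R - b)) \<longlongrightarrow> 0) at_top"
        using tendsto_mult_right_zero[OF tendsto_neg_powr[OF Rb filterlim_ident]] by simp
      show "c * half_power k R b y \<le> c * norm y powr (R - b)" if "0 \<le> y $ k" "1 \<le> norm y" for y
        using half_power_le[OF that, of R b] R c by simp
      show "c * half_power k R b y \<le> u (y + axis k 1)" if "0 \<le> y $ k" "norm y = 1" for y
      proof -
        have "c * half_power k R b y \<le> c * 1"
          using half_power_le[of y k R b] that R c(1) by (intro mult_left_mono) auto
        then show ?thesis using c(2)[OF that] by simp
      qed
    next
      fix y :: "real^'n" assume y: "0 < y $ k"
      obtain g H where H: "twice_diff (half_power k R b) y g H"
        "\<And>h. h \<bullet> H h = half_power k R b y * half_power_hess k R b y h"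
        using half_power_twice_diff[OF y] by metis
      have "twice_diff (\<lambda>y. c * half_power k R b y) y (c *\<^sub>R g) (\<lambda>h. c *\<^sub>R H h)"
        by (rule twice_diff_cmult[OF H(1)])
      moreover have "pucci_ge l L (\<lambda>h. c * (half_power k R b y * half_power_hess k R b y h)) (c * (half_power k R b y * 0))"
        using half_power_subsolution[OF n lL y] c(1)
        by (intro pucci_ge_cmult half_power_nonneg) (auto simp: R_def b_def)
      moreover have "f (y + axis k 1) > 0" using y by (intro pos(2)) (auto simp: half_space_def)
      ultimately show "\<exists>g H B. twice_diff (\<lambda>y. c * half_power k R b y) y g H \<and>
          pucci_ge l L (\<lambda>h. h \<bullet> H h) B \<and> B + f (y + axis k 1) > 0"
        by (intro exI[of _ "c *\<^sub>R g"] exI[of _ "\<lambda>h. c *\<^sub>R H h"] exI[of _ 0]) (simp add: H(2))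
    qed (use lL y pos in \<open>auto simp: half_power_eq_0 intro: less_imp_le\<close>)
  qed
qed

section \<open>Logarithmic lower bound at the critical exponents\<close>

text \<open>The second derivative of \<open>x_k^2\<close> in direction \<open>k\<close> does not
  degenerate at the flat boundary: the form is at least \<open>2 |x|^(- b)\<close> times
  \<open>(h_k)^2\<close>, up to an error proportional to \<open>x_k / |x|\<close>.\<close>

lemma half_power_square_subsolution:
  fixes x :: "real^'n"
  assumes x: "x $ k > 0" and lL: "0 \<le> l" "0 \<le> L" and b: "0 \<le> b"
  shows "pucci_ge l L (\<lambda>h. half_power k 2 b x * half_power_hess k 2 b x h)
    (norm x powr (- b) * (2 * l - 5 * b * L * real CARD('n) * (x $ k / norm x)))"
proof -
  define r where "r = norm x"
  define z where "z = x $ k / r"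
  have r: "r > 0" "x \<bullet> x = r\<^sup>2" using x by (auto simp: r_def power2_norm_eq_inner)
  have z: "0 < z" "z \<le> 1" "x $ k = z * r"
    using x r component_le_norm_cart[of x k] by (auto simp: z_def r_def)
  have ek: "axis k 1 \<bullet> h = h $ k" for h :: "real^'n" by (simp add: inner_axis')
  \<comment> \<open>Of the factor 5, the cross term takes 4 and the isotropic term takes 1 by
    \<open>z^2 \<le> z\<close>; the \<open>q^2\<close> term is nonnegative and dropped.\<close>
  have low: "2 * (axis k 1 \<bullet> h)\<^sup>2 + - (5 * b * z * (h \<bullet> h)) \<le> (x $ k)\<^sup>2 * half_power_hess k 2 b x h" for h
  proof -
    define q where "q = (x \<bullet> h) / r"
    have q: "\<bar>q\<bar> \<le> norm h"
      using Cauchy_Schwarz_ineq2[of x h] r by (simp add: q_def r_def abs_div divide_le_eq mult.commute)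
    have hk: "\<bar>h $ k\<bar> \<le> norm h" by (rule component_le_norm_cart)
    have "(x $ k)\<^sup>2 * half_power_hess k 2 b x h =
        (2 * (h $ k) - b * z * q)\<^sup>2 - 2 * (h $ k)\<^sup>2 - b * z\<^sup>2 * (h \<bullet> h) + 2 * b * z\<^sup>2 * q\<^sup>2"
      unfolding half_power_hess_def r(2) z(3) q_def using r(1) z(1) by (simp add: field_simps power2_eq_square)
    also have "\<dots> = 2 * (h $ k)\<^sup>2 - 4 * b * z * ((h $ k) * q) - b * z\<^sup>2 * (h \<bullet> h) + (b\<^sup>2 * z\<^sup>2 + 2 * b * z\<^sup>2) * q\<^sup>2"
      by (simp add: power2_eq_square algebra_simps)
    finally have eq: "(x $ k)\<^sup>2 * half_power_hess k 2 b x h = \<dots>" .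
    have "(h $ k) * q \<le> \<bar>h $ k\<bar> * \<bar>q\<bar>" by (simp add: abs_mult[symmetric])
    also have "\<dots> \<le> norm h * norm h" using hk q by (intro mult_mono) auto
    finally have "4 * b * z * ((h $ k) * q) \<le> 4 * b * z * (h \<bullet> h)"
      using b z(1) by (intro mult_left_mono) (auto simp: power2_norm_eq_inner[symmetric] power2_eq_square)
    moreover have "b * z\<^sup>2 * (h \<bullet> h) \<le> b * z * (h \<bullet> h)"
      using b z by (intro mult_right_mono mult_left_mono) (auto simp: power2_eq_square mult_left_le)
    moreover have "(b\<^sup>2 * z\<^sup>2 + 2 * b * z\<^sup>2) * q\<^sup>2 \<ge> 0" using b by simp
    ultimately show ?thesis unfolding eq ek by linarith
  qed
  have "pucci_ge l L (\<lambda>h. 2 * (axis k 1 \<bullet> h)\<^sup>2 + - (5 * b * z * (h \<bullet> h)))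
      (2 * (l * (axis k 1 \<bullet> (axis k 1 :: real^'n))) + - (L * (5 * b * z) * real CARD('n)))"
    using b z lL by (intro pucci_ge_add pucci_ge_cmult pucci_ge_inner_sq pucci_ge_neg_norm_sq) auto
  then have "pucci_ge l L (\<lambda>h. (x $ k)\<^sup>2 * half_power_hess k 2 b x h)
      (2 * l - 5 * b * L * real CARD('n) * z)"
    by (rule pucci_ge_mono) (use low lL in \<open>auto simp: mult.commute mult.left_commute\<close>)
  from pucci_ge_cmult[OF this, of "r powr (- b)"]
  show ?thesis
    using x by (simp add: half_power_def r_def[symmetric] z_def[symmetric] mult.assoc mult.left_commute)
qed

text \<open>These are the terms of the Hessian of \<open>half_power k a b y * ln (norm y)\<close> in
  which the logarithm is differentiated. Since \<open>a \<ge> 1\<close>, even the quotient of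
  \<open>half_power\<close> by \<open>x_k\<close> is bounded by a power of the norm, uniformly up to
  the flat boundary. The product of gradients accounts for \<open>2 (a + b)\<close>, the Hessian of
  the logarithm for \<open>1\<close>.\<close>

lemma half_power_log_cross_term:
  fixes x :: "real^'n"
  assumes x: "x $ k > 0" and ab: "1 \<le> a" "0 \<le> b"
    and g: "g = half_power k a b x *\<^sub>R ((a / x $ k) *\<^sub>R axis k 1 - (b / (x \<bullet> x)) *\<^sub>R x)"
  shows "- ((2 * (a + b) + 1) * norm x powr (a - b - 2) * (h \<bullet> h)) \<le>
    half_power k a b x * ((h \<bullet> h) / (x \<bullet> x) - 2 * (x \<bullet> h)\<^sup>2 / (x \<bullet> x)\<^sup>2) + 2 * (g \<bullet> h) * ((x \<bullet> h) / (x \<bullet> x)) "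
proof -
  define r where "r = norm x"
  define w where "w = r powr (a - b - 2)"
  define \<Phi> where "\<Phi> = half_power k a b x"
  have r: "r > 0" "x \<bullet> x = r\<^sup>2" using x by (auto simp: r_def power2_norm_eq_inner)
  have kr: "x $ k \<le> r" using component_le_norm_cart[of x k] by (simp add: r_def)
  have w: "w > 0" using r by (simp add: w_def)
  have rw: "r powr (a - b) = r\<^sup>2 * w" "r powr (a - b - 1) = r * w"
    using r by (auto simp: w_def powr_diff power2_eq_square)
  have \<Phi>: "0 \<le> \<Phi>" by (simp add: \<Phi>_def half_power_nonneg)
  have \<Phi>1: "\<Phi> / x $ k \<le> r * w"
  proof -
    have "\<Phi> / x $ k = (x $ k) powr (a - 1) * r powr (- b)"
      using x by (simp add: \<Phi>_def half_power_def r_def powr_diff)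
    also have "\<dots> \<le> r powr (a - 1) * r powr (- b)"
      using x kr ab by (intro mult_right_mono powr_mono2) auto
    also have "\<dots> = r powr (a - b - 1)" by (simp add: powr_add[symmetric] algebra_simps)
    finally show ?thesis by (simp add: rw)
  qed
  have \<Phi>2: "\<Phi> \<le> r\<^sup>2 * w"
  proof -
    have "\<Phi> \<le> x $ k * (r * w)" using \<Phi>1 x by (simp add: divide_le_eq mult.commute)
    also have "\<dots> \<le> r * (r * w)" using kr r w by (intro mult_right_mono) auto
    finally show ?thesis by (simp add: power2_eq_square)
  qed
  have hh: "h \<bullet> h = (norm h)\<^sup>2" by (simp add: power2_norm_eq_inner)
  have xh: "\<bar>x \<bullet> h\<bar> \<le> r * norm h" unfolding r_def by (rule Cauchy_Schwarz_ineq2)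
  have gh: "\<bar>g \<bullet> h\<bar> \<le> (a + b) * (r * w) * norm h"
  proof -
    have "g \<bullet> h = a * (\<Phi> / x $ k) * (h $ k) - b * (\<Phi> / r\<^sup>2) * (x \<bullet> h)"
      by (simp add: g \<Phi>_def inner_diff_left inner_axis' r(2) algebra_simps)
    also have "\<bar>\<dots>\<bar> \<le> \<bar>a * (\<Phi> / x $ k) * (h $ k)\<bar> + \<bar>b * (\<Phi> / r\<^sup>2) * (x \<bullet> h)\<bar>" by (rule abs_triangle_ineq4)
    also have "\<bar>a * (\<Phi> / x $ k) * (h $ k)\<bar> \<le> a * (r * w) * norm h"
      using ab \<Phi> x \<Phi>1 component_le_norm_cart[of h k] r w unfolding abs_mult
      by (intro mult_mono) auto
    also have "\<bar>b * (\<Phi> / r\<^sup>2) * (x \<bullet> h)\<bar> \<le> b * w * (r * norm h)"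
      using ab \<Phi> \<Phi>2 xh r w unfolding abs_mult
      by (intro mult_mono) (auto simp: divide_le_eq mult.commute)
    finally show ?thesis by (simp add: algebra_simps)
  qed
  have "- (2 * (g \<bullet> h) * ((x \<bullet> h) / r\<^sup>2)) = 2 * (- ((g \<bullet> h) * (x \<bullet> h))) / r\<^sup>2" by simp
  also have "\<dots> \<le> 2 * (\<bar>g \<bullet> h\<bar> * \<bar>x \<bullet> h\<bar>) / r\<^sup>2"
    unfolding abs_mult[symmetric] by (intro divide_right_mono mult_left_mono) auto
  also have "\<dots> \<le> 2 * (((a + b) * (r * w) * norm h) * (r * norm h)) / r\<^sup>2"
    using gh xh ab r w by (intro divide_right_mono mult_left_mono mult_mono) auto
  also have "\<dots> = 2 * (a + b) * w * (h \<bullet> h)" using r by (simp add: hh power2_eq_square)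
  finally have 1: "- (2 * (g \<bullet> h) * ((x \<bullet> h) / r\<^sup>2)) \<le> 2 * (a + b) * w * (h \<bullet> h)" .
  have "- ((h \<bullet> h) / r\<^sup>2) \<le> (h \<bullet> h) / r\<^sup>2 - 2 * (x \<bullet> h)\<^sup>2 / (r\<^sup>2)\<^sup>2"
  proof -
    have "(x \<bullet> h)\<^sup>2 \<le> r\<^sup>2 * (h \<bullet> h)" using Cauchy_Schwarz_ineq[of x h] r by simp
    then have "(x \<bullet> h)\<^sup>2 / (r\<^sup>2)\<^sup>2 \<le> r\<^sup>2 * (h \<bullet> h) / (r\<^sup>2)\<^sup>2" by (rule divide_right_mono) simp
    also have "\<dots> = (h \<bullet> h) / r\<^sup>2" using r by (simp add: power2_eq_square)
    finally show ?thesis by simp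
  qed
  from mult_left_mono[OF this \<Phi>] have "- (\<Phi> / r\<^sup>2 * (h \<bullet> h)) \<le> \<Phi> * ((h \<bullet> h) / r\<^sup>2 - 2 * (x \<bullet> h)\<^sup>2 / (r\<^sup>2)\<^sup>2)"
    by simp
  moreover have "\<Phi> / r\<^sup>2 * (h \<bullet> h) \<le> w * (h \<bullet> h)"
    using \<Phi>2 r by (intro mult_right_mono) (auto simp: divide_le_eq mult.commute)
  moreover have "(2 * (a + b) + 1) * w * (h \<bullet> h) = 2 * (a + b) * w * (h \<bullet> h) + w * (h \<bullet> h)"
    by (simp add: algebra_simps)
  ultimately show ?thesis
    using 1 unfolding r(2) r_def[symmetric] w_def[symmetric] \<Phi>_def[symmetric] by linarith
qed

text \<open>Near the flat boundary the cross terms of \<open>half_power k a b y * ln (norm y)\<close> are not controlled by the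
  right-hand side of the equation; the Hessian of \<open>half_power k 2 b'\<close>, which has the same homogeneity,
  absorbs them there.\<close>

lemma half_power_log_twice_diff:
  fixes x :: "real^'n"
  assumes x: "x $ k > 0" and b: "1 \<le> a" "0 \<le> b" "1 \<le> norm x" and lL: "0 \<le> l" "0 \<le> L"
    and sub: "pucci_ge l L (half_power_hess k a b x) 0" and c: "0 \<le> c" and b': "b' = b - a + 2" "0 \<le> b'"
  obtains g H where
    "twice_diff (\<lambda>y. half_power k a b y * ln (norm y) + c * half_power k 2 b' y) x g H"
    "pucci_ge l L (\<lambda>h. h \<bullet> H h) (norm x powr (a - b - 2) *
       (c * (2 * l - 5 * b' * L * real CARD('n) * (x $ k / norm x)) - (2 * (a + b) + 1) * L * real CARD('n)))"
proof -
  define s where "s = (x - 0) \<bullet> (x - 0)"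
  have s: "s > 0" "s = x \<bullet> x" using x by (auto simp: s_def)
  have ln_norm: "ln (norm y) = 1 / 2 * ln ((y - 0) \<bullet> (y - 0))" for y :: "real^'n"
    by (cases "y = 0") (simp_all add: norm_eq_sqrt_inner ln_sqrt)
  define \<Phi> where "\<Phi> = half_power k a b x"
  define w where "w = norm x powr (a - b - 2)"
  obtain H1 where 1: "twice_diff (half_power k a b) x (\<Phi> *\<^sub>R ((a / x $ k) *\<^sub>R axis k 1 - (b / (x \<bullet> x)) *\<^sub>R x)) H1"
    "\<And>h. h \<bullet> H1 h = \<Phi> * half_power_hess k a b x h"
    using half_power_twice_diff[OF x] unfolding \<Phi>_def by blast
  define g1 where "g1 = \<Phi> *\<^sub>R ((a / x $ k) *\<^sub>R axis k 1 - (b / (x \<bullet> x)) *\<^sub>R x)"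
  define g2 where "g2 = (1 / 2) *\<^sub>R ((1 / s) *\<^sub>R (2 *\<^sub>R (x - 0)))"
  define H2 where "H2 h = (1 / 2 :: real) *\<^sub>R ((1 / s) *\<^sub>R (2 *\<^sub>R h)
      + (- (1 / s\<^sup>2) * ((2 *\<^sub>R (x - 0)) \<bullet> h)) *\<^sub>R (2 *\<^sub>R (x - 0)))" for h
  have 2: "twice_diff (\<lambda>y. ln (norm y)) x g2 H2"
    unfolding ln_norm g2_def H2_def s_def
    by (intro twice_diff_cmult twice_diff_ln twice_diff_norm_sq) (use s in \<open>simp add: s_def\<close>)
  obtain g3 H3 where 3: "twice_diff (half_power k 2 b') x g3 H3"
    "\<And>h. h \<bullet> H3 h = half_power k 2 b' x * half_power_hess k 2 b' x h"
    using half_power_twice_diff[OF x, of 2 b'] by blast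
  note td = twice_diff_add[OF twice_diff_mult[OF 1(1)[folded g1_def] 2] twice_diff_cmult[OF 3(1), of c]]
  have quad: "h \<bullet> (half_power k a b x *\<^sub>R H2 h + (g1 \<bullet> h) *\<^sub>R g2 + (ln (norm x) *\<^sub>R H1 h + (g2 \<bullet> h) *\<^sub>R g1) + c *\<^sub>R H3 h)
      = ln (norm x) * \<Phi> * half_power_hess k a b x h
        + (\<Phi> * ((h \<bullet> h) / (x \<bullet> x) - 2 * (x \<bullet> h)\<^sup>2 / (x \<bullet> x)\<^sup>2) + 2 * (g1 \<bullet> h) * ((x \<bullet> h) / (x \<bullet> x))
        + c * (half_power k 2 b' x * half_power_hess k 2 b' x h))" for h
  proof -
    have "h \<bullet> g2 = (x \<bullet> h) / (x \<bullet> x)" "g2 \<bullet> h = (x \<bullet> h) / (x \<bullet> x)"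
      by (simp_all add: g2_def s(2) inner_commute)
    moreover have "h \<bullet> H2 h = (h \<bullet> h) / (x \<bullet> x) - 2 * (x \<bullet> h)\<^sup>2 / (x \<bullet> x)\<^sup>2"
      by (simp add: H2_def s(2) inner_add_right inner_diff_right inner_commute power2_eq_square)
         (simp add: algebra_simps)
    ultimately show ?thesis
      by (simp add: inner_add_right 1(2) 3(2) inner_commute[of h g1] \<Phi>_def[symmetric] distrib_left)
  qed
  have w': "norm x powr (- b') = w" by (simp add: w_def b'(1) algebra_simps)
  \<comment> \<open>As \<open>norm x \<ge> 1\<close>, the factor in front of
    \<open>half_power_hess k a b\<close> is nonnegative, so \<open>sub\<close> makes the logarithmic
    term contribute \<open>0\<close>.\<close>
  have "pucci_ge l L (\<lambda>h. ln (norm x) * \<Phi> * half_power_hess k a b x h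
      + (- ((2 * (a + b) + 1) * w * (h \<bullet> h)) + c * (half_power k 2 b' x * half_power_hess k 2 b' x h)))
     (ln (norm x) * \<Phi> * 0 + (- (L * ((2 * (a + b) + 1) * w) * real CARD('n))
      + c * (w * (2 * l - 5 * b' * L * real CARD('n) * (x $ k / norm x)))))"
    using b lL c x b'(2)
    by (intro pucci_ge_add pucci_ge_cmult sub pucci_ge_neg_norm_sq
        half_power_square_subsolution[of x k l L b', unfolded w'])
       (auto simp: \<Phi>_def half_power_nonneg w_def)
  then have "pucci_ge l L (\<lambda>h. h \<bullet> (half_power k a b x *\<^sub>R H2 h + (g1 \<bullet> h) *\<^sub>R g2 + (ln (norm x) *\<^sub>R H1 h + (g2 \<bullet> h) *\<^sub>R g1) + c *\<^sub>R H3 h))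
    (w * (c * (2 * l - 5 * b' * L * real CARD('n) * (x $ k / norm x)) - (2 * (a + b) + 1) * L * real CARD('n)))"
  proof (rule pucci_ge_mono)
    fix h
    show "ln (norm x) * \<Phi> * half_power_hess k a b x h
      + (- ((2 * (a + b) + 1) * w * (h \<bullet> h)) + c * (half_power k 2 b' x * half_power_hess k 2 b' x h))
      \<le> h \<bullet> (half_power k a b x *\<^sub>R H2 h + (g1 \<bullet> h) *\<^sub>R g2 + (ln (norm x) *\<^sub>R H1 h + (g2 \<bullet> h) *\<^sub>R g1) + c *\<^sub>R H3 h)"
      using half_power_log_cross_term[OF x b(1,2) g1_def[unfolded \<Phi>_def], of h]
      unfolding quad w_def \<Phi>_def by linarith
  qed (use lL in \<open>simp_all add: algebra_simps\<close>)
  then show thesis using that[OF td] unfolding w_def by blast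
qed

text \<open>The relation for \<open>(b - a) * p\<close> gives the lower bound of the source the
  degree \<open>a - b - 2\<close> of the Hessian of the barrier. Where \<open>x_k / |x|\<close> is
  at most \<open>\<delta>\<close>, the corrector \<open>half_power k 2 b'\<close> controls the cross
  terms; elsewhere the source does.\<close>

lemma half_power_log_lower_bound:
  fixes u :: "real^'n \<Rightarrow> real"
  assumes n: "CARD('n) \<ge> 2" and lL: "0 < l" "l \<le> L"
    and u: "visc_supersol l L (half_space k) u f" and cont: "continuous_on (half_space k) u"
    and pos: "\<And>x. x \<in> half_space k \<Longrightarrow> 0 < u x" "\<And>x. x \<in> half_space k \<Longrightarrow> 0 < f x"
    and a: "a = L / l" and b: "b = L / l * (real CARD('n) + 1) - 1"
    and p: "(b - a) * p = b - a + 2" "0 < p"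
    and c0: "c0 > 0" "\<And>y. 0 \<le> y $ k \<Longrightarrow> 1 \<le> norm y \<Longrightarrow> (c0 * half_power k a b y) powr p \<le> f (y + axis k 1)"
  obtains c where "c > 0" "\<And>y. 0 \<le> y $ k \<Longrightarrow> 1 \<le> norm y \<Longrightarrow>
    c * (half_power k a b y * ln (norm y)) \<le> u (y + axis k 1)"
proof -
  define N where "N = real CARD('n)"
  define b' where "b' = b - a + 2"
  have N: "N \<ge> 2" using n by (simp add: N_def)
  have a1: "a \<ge> 1" using lL by (simp add: a)
  have aN: "a * N \<ge> 2" using mult_mono[of 1 a 2 N] a1 N by simp
  have ba: "b - a = a * N - 1" by (simp add: a b N_def algebra_simps)
  have b0: "b \<ge> 0" and b'0: "b' > 0" and ab: "a - b < 0" using aN ba a1 by (auto simp: b'_def)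
  \<comment> \<open>\<open>C l\<close> equals the bound for the cross terms, so half of the main
    term \<open>2 l\<close> of the corrector pays for them and \<open>l\<close> remains.\<close>
  define C where "C = (2 * (a + b) + 1) * L * N / l"
  have L0: "L > 0" using lL by simp
  have C: "C > 0" using a1 b0 L0 N lL by (simp add: C_def)
  \<comment> \<open>The value of \<open>x_k / |x|\<close> at which the error of the corrector uses
    up the remaining \<open>l\<close>. Beyond it, \<open>m\<close> bounds the source from below
    relative to \<open>w\<close>.\<close>
  define \<delta> where "\<delta> = l / (5 * b' * L * N)"
  have \<delta>: "\<delta> > 0" using b'0 L0 N lL by (simp add: \<delta>_def)
  define m where "m = (c0 * \<delta> powr a) powr p"
  have m: "m > 0" using c0(1) \<delta> by (simp add: m_def)
  obtain cu where cu: "cu > 0" "\<And>y. 0 \<le> y $ k \<Longrightarrow> norm y = 1 \<Longrightarrow> cu \<le> u (y + axis k 1)"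
    using positive_on_half_sphere[OF cont pos(1)] by blast
  \<comment> \<open>The first entry serves the unit half-sphere, where the logarithm vanishes and
    \<open>\<psi> \<le> C\<close>. The second, with a factor 2 for strictness, lets the source
    outweigh the most negative value of the bound for the operator.\<close>
  define c where "c = min (cu / C) (m / (2 * (C * (5 * b' * L * N))))"
  have c: "c > 0" "c * C \<le> cu" "c * (C * (5 * b' * L * N)) < m"
  proof -
    have D: "C * (5 * b' * L * N) > 0" using C b'0 L0 N by simp
    show "c > 0" using C m cu(1) D by (simp add: c_def)
    have "c \<le> cu / C" by (simp add: c_def)
    then show "c * C \<le> cu" using C by (simp add: le_divide_eq)
    have "c * (C * (5 * b' * L * N)) \<le> m / (2 * (C * (5 * b' * L * N))) * (C * (5 * b' * L * N))"
      using D by (intro mult_right_mono) (auto simp: c_def)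
    also have "\<dots> = m / 2"
    proof -
      have "m / (2 * t) * t = m / 2" if "t > 0" for t :: real using that by simp
      then show ?thesis using D .
    qed
    finally show "c * (C * (5 * b' * L * N)) < m" using m by simp
  qed
  define \<psi> where "\<psi> y = half_power k a b y * ln (norm y) + C * half_power k 2 b' y" for y :: "real^'n"
  have "c * \<psi> y \<le> u (y + axis k 1)" if y: "0 \<le> y $ k" "1 \<le> norm y" for y
  proof (rule exterior_comparison[OF u _ lL(2) cont, where \<phi> = "\<lambda>y. c * \<psi> y" and d = "\<lambda>r. c * (r powr (a - b) * ln r + C * r powr (a - b))"])
    show "continuous_on {y. 0 \<le> y $ k \<and> 1 \<le> norm y} (\<lambda>y. c * \<psi> y)"
      unfolding \<psi>_def using a1 by (intro continuous_intros half_power_continuous) auto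
    show "((\<lambda>r. c * (r powr (a - b) * ln r + C * r powr (a - b))) \<longlongrightarrow> 0) at_top"
      using ab by real_asymp
    have le: "\<psi> y \<le> norm y powr (a - b) * ln (norm y) + C * norm y powr (a - b)" if "0 \<le> y $ k" "1 \<le> norm y" for y
      unfolding \<psi>_def using half_power_le[OF that, of a b] half_power_le[OF that, of 2 b'] that a1 C
      by (intro add_mono mult_right_mono mult_left_mono) (auto simp: b'_def)
    then show "c * \<psi> y \<le> c * (norm y powr (a - b) * ln (norm y) + C * norm y powr (a - b))"
      if "0 \<le> y $ k" "1 \<le> norm y" for y using that c(1) by simp
    show "c * \<psi> y \<le> u (y + axis k 1)" if "0 \<le> y $ k" "norm y = 1" for y
    proof -
      have "c * \<psi> y \<le> c * C" using le[of y] that c(1) by (intro mult_left_mono) auto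
      then show ?thesis using cu(2)[OF that] c(2) by simp
    qed
  next
    fix y :: "real^'n" assume y: "0 < y $ k" "1 < norm y"
    define z where "z = y $ k / norm y"
    define w where "w = norm y powr (a - b - 2)"
    have w: "w > 0" using y(1) by (auto simp: w_def)
    have sub: "pucci_ge l L (half_power_hess k a b y) 0"
      using half_power_subsolution[OF n lL y(1)] by (simp add: a b)
    obtain g H where gH: "twice_diff \<psi> y g H" "pucci_ge l L (\<lambda>h. h \<bullet> H h)
       (w * (C * (2 * l - 5 * b' * L * N * z) - (2 * (a + b) + 1) * L * N))"
      using half_power_log_twice_diff[OF y(1) a1 b0 _ _ _ sub, of C b'] y lL C b'0
      unfolding \<psi>_def w_def N_def z_def b'_def by auto
    have B: "C * (2 * l - 5 * b' * L * N * z) - (2 * (a + b) + 1) * L * N = C * (l - 5 * b' * L * N * z)"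
    proof -
      have "(2 * (a + b) + 1) * L * N = C * l" using lL by (simp add: C_def)
      then show ?thesis by (simp add: algebra_simps)
    qed
    have "twice_diff (\<lambda>y. c * \<psi> y) y (c *\<^sub>R g) (\<lambda>h. c *\<^sub>R H h)"
      by (rule twice_diff_cmult[OF gH(1)])
    moreover have "pucci_ge l L (\<lambda>h. h \<bullet> (c *\<^sub>R H h)) (c * (w * (C * (l - 5 * b' * L * N * z))))"
      using pucci_ge_cmult[OF gH(2)[unfolded B], of c] c(1) by simp
    moreover have "c * (w * (C * (l - 5 * b' * L * N * z))) + f (y + axis k 1) > 0"
    proof (cases "z \<le> \<delta>")
      case True
      then have "5 * b' * L * N * z \<le> l" using b'0 L0 N by (simp add: \<delta>_def le_divide_eq mult_ac)
      then have "c * (w * (C * (l - 5 * b' * L * N * z))) \<ge> 0" using c(1) w C by simp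
      moreover have "f (y + axis k 1) > 0" using y by (intro pos(2)) (auto simp: half_space_def)
      ultimately show ?thesis by simp
    next
      case False
      have z: "0 < z" "z \<le> 1"
        using y component_le_norm_cart[of y k] less_trans[OF zero_less_one y(2)] by (auto simp: z_def divide_le_eq)
      have "- (C * (5 * b' * L * N)) \<le> C * (l - 5 * b' * L * N * z)"
      proof -
        have "5 * b' * L * N * z \<le> 5 * b' * L * N * 1" using z b'0 L0 N by (intro mult_left_mono) auto
        then have "- (5 * b' * L * N) \<le> l - 5 * b' * L * N * z" using lL by simp
        from mult_left_mono[OF this, of C] C show ?thesis by simp
      qed
      then have "c * w * (- (C * (5 * b' * L * N))) \<le> c * w * (C * (l - 5 * b' * L * N * z))"
        using c(1) w by (intro mult_left_mono) auto
      then have 1: "- (w * (c * (C * (5 * b' * L * N)))) \<le> c * (w * (C * (l - 5 * b' * L * N * z)))"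
        by (simp add: mult_ac)
      have 2: "w * (c * (C * (5 * b' * L * N))) < w * m" using c(3) w by simp
      have "half_power k a b y = z powr a * norm y powr (a - b)"
        using y z by (simp add: half_power_def z_def powr_divide powr_diff powr_minus divide_simps)
      moreover have "\<delta> powr a \<le> z powr a" using False \<delta> a1 by (intro powr_mono2) auto
      ultimately have "\<delta> powr a * norm y powr (a - b) \<le> half_power k a b y"
        by (simp add: mult_right_mono)
      then have "c0 * (\<delta> powr a * norm y powr (a - b)) \<le> c0 * half_power k a b y"
        using c0(1) by simp
      then have "(c0 * (\<delta> powr a * norm y powr (a - b))) powr p \<le> (c0 * half_power k a b y) powr p"
        using c0(1) p(2) by (intro powr_mono2) auto
      also have "(c0 * (\<delta> powr a * norm y powr (a - b))) powr p = m * w"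
      proof -
        have "(a - b) * p = a - b - 2" using p(1) by (simp add: algebra_simps)
        then show ?thesis using c0(1) by (simp add: m_def w_def powr_mult powr_powr mult.assoc)
      qed
      finally have "m * w \<le> f (y + axis k 1)" using c0(2)[of y] y by simp
      then show ?thesis using 1 2 by (simp add: mult.commute[of m])
    qed
    ultimately show "\<exists>g H B. twice_diff (\<lambda>y. c * \<psi> y) y g H \<and>
        pucci_ge l L (\<lambda>h. h \<bullet> H h) B \<and> B + f (y + axis k 1) > 0"
      by blast
  qed (use lL y pos in \<open>auto simp: half_power_eq_0 \<psi>_def intro: less_imp_le\<close>)
  moreover have "c * (half_power k a b y * ln (norm y)) \<le> c * \<psi> y" for y
    using c(1) C half_power_nonneg[of k 2 b' y] by (simp add: \<psi>_def)
  ultimately show thesis using c(1) that order_trans by metis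
qed

subsection \<open>Scaling estimates and nonexistence\<close>

text \<open>The paraboloid under \<open>u\<close> yields a point near \<open>x\<close> where
  \<open>v^p\<close> is controlled, and the Gaussian bound carries this over to \<open>v z\<close>.
  Height \<open>4 \<rho>\<close> leaves room for the radii \<open>\<rho>\<close>,
  \<open>2 \<rho>\<close> and \<open>3 \<rho>\<close> in the half-space, so the constant does not
  depend on the scale.\<close>

lemma min_powr_le:
  fixes u v :: "real^'n \<Rightarrow> real"
  assumes lL: "0 < l" "l \<le> L" and p: "0 < p"
    and u: "visc_supersol l L (half_space k) u (\<lambda>x. v x powr p)" "continuous_on (half_space k) u"
    and v: "visc_supersol l L (half_space k) v f" "continuous_on (half_space k) v"
    and pos: "\<And>x. x \<in> half_space k \<Longrightarrow> 0 < u x" "\<And>x. x \<in> half_space k \<Longrightarrow> 0 < v x"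
      "\<And>x. x \<in> half_space k \<Longrightarrow> 0 \<le> f x"
  obtains C where "C > 0" "\<And>\<rho> x z. 0 < \<rho> \<Longrightarrow> x \<in> cball (axis k (4 * \<rho>)) \<rho> \<Longrightarrow> z \<in> half_space k \<Longrightarrow>
    (\<And>y. y \<in> cball (axis k (4 * \<rho>)) \<rho> \<Longrightarrow> v z \<le> v y) \<Longrightarrow> v z powr p \<le> C * u x / \<rho>\<^sup>2"
proof -
  define N where "N = real CARD('n)"
  define \<kappa> where "\<kappa> = N * L / l"
  have N: "N > 0" by (simp add: N_def)
  have \<kappa>: "\<kappa> > 0" using lL N by (simp add: \<kappa>_def)
  \<comment> \<open>Difference of the Gaussian at radii \<open>2 \<rho>\<close> and
    \<open>3 \<rho>\<close>; \<open>t \<rho>^2 = \<kappa>\<close> for every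
    \<open>\<rho>\<close>.\<close>
  define c where "c = exp (- (4 * \<kappa>)) - exp (- (9 * \<kappa>))"
  have c: "c > 0" using \<kappa> by (simp add: c_def)
  define C where "C = 2 * N * L / c powr p"
  show thesis
  proof (rule that[of C])
    show "C > 0" using lL N c by (simp add: C_def)
    fix \<rho> x z assume \<rho>: "0 < \<rho>" and x: "x \<in> cball (axis k (4 * \<rho>)) \<rho>" and z: "z \<in> half_space k"
      "\<And>y. y \<in> cball (axis k (4 * \<rho>)) \<rho> \<Longrightarrow> v z \<le> v y"
    define y where "y = (axis k (4 * \<rho>) :: real^'n)"
    have sub: "cball y (3 * \<rho>) \<subseteq> half_space k"
    proof
      fix a assume "a \<in> cball y (3 * \<rho>)"
      then have "\<bar>(y - a) $ k\<bar> \<le> 3 * \<rho>" using component_le_norm_cart[of "y - a" k] by (simp add: dist_norm)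
      then have "a $ k \<ge> \<rho>" by (simp add: y_def)
      then show "a \<in> half_space k" using \<rho> by (simp add: half_space_def)
    qed
    have sub2: "cball x \<rho> \<subseteq> cball y (2 * \<rho>)"
    proof
      fix a assume "a \<in> cball x \<rho>"
      then show "a \<in> cball y (2 * \<rho>)" using x dist_triangle[of y a x] by (simp add: y_def)
    qed
    then have sub3: "cball x \<rho> \<subseteq> half_space k" using sub \<rho> by (force simp: subset_iff)
    obtain a where a: "a \<in> ball x \<rho>" "v a powr p \<le> 2 * N * L * u x / \<rho>\<^sup>2"
      using paraboloid_estimate[OF u(1) lL u(2) _ sub3 \<rho>] pos(1) unfolding N_def by (metis less_imp_le)
    have ay: "a \<in> cball y (2 * \<rho>)" using a(1) sub2 by (auto simp: subset_iff)
    define t where "t = N * L / (l * \<rho>\<^sup>2)"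
    have t: "t * \<rho>\<^sup>2 = \<kappa>" using \<rho> lL by (simp add: t_def \<kappa>_def)
    have t0: "t > 0" using \<rho> lL N by (simp add: t_def)
    have vz: "v z > 0" using z pos by simp
    have "v z * (exp (- t * (norm (a - y))\<^sup>2) - exp (- t * (3 * \<rho>)\<^sup>2)) \<le> v a"
      using vz z(2) \<rho> ay pos
      by (intro gaussian_lower_bound[OF v(1) lL pos(3) v(2) _ sub \<rho> _ _ _ _ t_def[unfolded N_def]])
         (auto simp: y_def less_imp_le)
    moreover have "c \<le> exp (- t * (norm (a - y))\<^sup>2) - exp (- t * (3 * \<rho>)\<^sup>2)"
    proof -
      have "(norm (a - y))\<^sup>2 \<le> (2 * \<rho>)\<^sup>2"
        using ay by (intro power_mono) (auto simp: dist_norm norm_minus_commute)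
      then have "t * (norm (a - y))\<^sup>2 \<le> t * (2 * \<rho>)\<^sup>2" using t0 by (intro mult_left_mono) auto
      also have "\<dots> = 4 * \<kappa>" using t by (simp add: power_mult_distrib)
      finally have "t * (norm (a - y))\<^sup>2 \<le> 4 * \<kappa>" .
      moreover have "- t * (3 * \<rho>)\<^sup>2 = - (9 * \<kappa>)" using t by (simp add: power_mult_distrib)
      ultimately show ?thesis unfolding c_def by (metis diff_right_mono exp_le_cancel_iff minus_mult_left neg_le_iff_le)
    qed
    ultimately have "v z * c \<le> v a" using vz by (meson less_imp_le mult_left_mono order_trans)
    then have "(v z * c) powr p \<le> v a powr p" using vz c p by (intro powr_mono2) auto
    then have "v z powr p * c powr p \<le> 2 * N * L * u x / \<rho>\<^sup>2" using a(2) vz c by (simp add: powr_mult)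
    then have "v z powr p \<le> 2 * N * L * u x / \<rho>\<^sup>2 / c powr p" using c by (simp add: pos_le_divide_eq del: divide_divide_eq_left)
    then show "v z powr p \<le> C * u x / \<rho>\<^sup>2" by (simp add: C_def mult_ac)
  qed
qed

lemma powr_divide_sq:
  fixes C \<rho> s :: real
  assumes "0 < C" "0 < \<rho>"
  shows "(C / \<rho>\<^sup>2) powr s = C powr s * \<rho> powr (- (2 * s))"
proof -
  have "C / \<rho>\<^sup>2 = C * \<rho> powr (- 2)" using assms by (simp add: powr_minus divide_inverse)
  then show ?thesis using assms by (simp add: powr_mult powr_powr)
qed

text \<open>At minimisers \<open>x\<close> of \<open>u\<close> and \<open>z\<close> of
  \<open>v\<close> over the ball, the two estimates read \<open>(v z)^p \<le> D u x\<close> and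
  \<open>(u x)^q \<le> D v z\<close> with \<open>D = C / \<rho>^2\<close>; \<open>v z\<close> is
  eliminated. One point of the ball is enough, as the later lower bounds hold at all of its
  points.\<close>

lemma system_decay:
  fixes u v :: "real^'n \<Rightarrow> real"
  assumes lL: "0 < l" "l \<le> L" and p: "0 < p" and q: "0 < q"
    and sol: "nonneg_supersolution l L p q k u v"
    and pos: "\<And>x. x \<in> half_space k \<Longrightarrow> 0 < u x" "\<And>x. x \<in> half_space k \<Longrightarrow> 0 < v x"
  obtains C where "C > 0"
    "\<And>\<rho>. 0 < \<rho> \<Longrightarrow> \<exists>x\<in>cball (axis k (4 * \<rho>)) \<rho>. u x powr (p * q - 1) \<le> (C / \<rho>\<^sup>2) powr (p + 1)"
proof -
  have sol': "continuous_on (half_space k) u" "continuous_on (half_space k) v"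
    "visc_supersol l L (half_space k) u (\<lambda>x. v x powr p)" "visc_supersol l L (half_space k) v (\<lambda>x. u x powr q)"
    using sol by (auto simp: nonneg_supersolution_def)
  obtain C1 where C1: "C1 > 0" "\<And>\<rho> x z. 0 < \<rho> \<Longrightarrow> x \<in> cball (axis k (4 * \<rho>)) \<rho> \<Longrightarrow> z \<in> half_space k \<Longrightarrow>
    (\<And>y. y \<in> cball (axis k (4 * \<rho>)) \<rho> \<Longrightarrow> v z \<le> v y) \<Longrightarrow> v z powr p \<le> C1 * u x / \<rho>\<^sup>2"
    using min_powr_le[OF lL p sol'(3,1,4,2) pos] powr_ge_zero by metis
  obtain C2 where C2: "C2 > 0" "\<And>\<rho> x z. 0 < \<rho> \<Longrightarrow> x \<in> cball (axis k (4 * \<rho>)) \<rho> \<Longrightarrow> z \<in> half_space k \<Longrightarrow>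
    (\<And>y. y \<in> cball (axis k (4 * \<rho>)) \<rho> \<Longrightarrow> u z \<le> u y) \<Longrightarrow> u z powr q \<le> C2 * v x / \<rho>\<^sup>2"
    using min_powr_le[OF lL q sol'(4,2,3,1) pos(2,1)] powr_ge_zero by metis
  define C where "C = max C1 C2"
  have C: "C > 0" "C1 \<le> C" "C2 \<le> C" using C1(1) by (auto simp: C_def)
  show thesis
  proof (rule that[OF C(1)])
    fix \<rho> :: real assume \<rho>: "0 < \<rho>"
    let ?K = "cball (axis k (4 * \<rho>)) \<rho> :: (real^'n) set"
    have sub: "?K \<subseteq> half_space k"
    proof
      fix a :: "real^'n" assume "a \<in> ?K"
      then have "\<bar>(axis k (4 * \<rho>) - a) $ k\<bar> \<le> \<rho>"
        using component_le_norm_cart[of "axis k (4 * \<rho>) - a" k] by (simp add: dist_norm)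
      then show "a \<in> half_space k" using \<rho> by (simp add: half_space_def)
    qed
    have ne: "?K \<noteq> {}" using \<rho> by simp
    obtain x where x: "x \<in> ?K" "\<And>y. y \<in> ?K \<Longrightarrow> u x \<le> u y"
      using continuous_attains_inf[OF compact_cball ne continuous_on_subset[OF sol'(1) sub]] by blast
    obtain z where z: "z \<in> ?K" "\<And>y. y \<in> ?K \<Longrightarrow> v z \<le> v y"
      using continuous_attains_inf[OF compact_cball ne continuous_on_subset[OF sol'(2) sub]] by blast
    have xz: "x \<in> half_space k" "z \<in> half_space k" using x z sub by auto
    have U: "u x > 0" and V: "v z > 0" using xz pos by auto
    define D where "D = C / \<rho>\<^sup>2"
    have D: "D > 0" using C \<rho> by (simp add: D_def)
    have "v z powr p \<le> C1 * u x / \<rho>\<^sup>2" using C1(2)[OF \<rho> x(1) xz(2) z(2)] .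
    also have "\<dots> \<le> C * u x / \<rho>\<^sup>2" using C U by (intro divide_right_mono mult_right_mono) auto
    finally have 1: "v z powr p \<le> D * u x" by (simp add: D_def)
    have "u x powr q \<le> C2 * v z / \<rho>\<^sup>2" using C2(2)[OF \<rho> z(1) xz(1) x(2)] .
    also have "\<dots> \<le> C * v z / \<rho>\<^sup>2" using C V by (intro divide_right_mono mult_right_mono) auto
    finally have 2: "u x powr q \<le> D * v z" by (simp add: D_def)
    have "u x powr (p * q) = (u x powr q) powr p" by (simp add: powr_powr mult.commute)
    also have "\<dots> \<le> (D * v z) powr p" using 2 p by (intro powr_mono2) auto
    also have "\<dots> = D powr p * v z powr p" using D V by (simp add: powr_mult)
    also have "\<dots> \<le> D powr p * (D * u x)" using 1 by (intro mult_left_mono) auto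
    also have "\<dots> = D powr (p + 1) * u x" using D by (simp add: powr_add)
    finally have "u x powr (p * q - 1) \<le> D powr (p + 1)"
      using U by (simp add: powr_diff divide_le_eq)
    then show "\<exists>x\<in>?K. u x powr (p * q - 1) \<le> (C / \<rho>\<^sup>2) powr (p + 1)"
      using x(1) by (auto simp: D_def)
  qed
qed

text \<open>\<open>\<rho> \<ge> 1\<close> absorbs the unit shift: on this ball the height is at
  least \<open>3 \<rho>\<close> and the norm at most \<open>5 \<rho>\<close>, and the shift worsens
  these to \<open>2 \<rho>\<close> and \<open>6 \<rho>\<close>.\<close>

lemma half_power_on_cball:
  fixes x :: "real^'n"
  assumes \<rho>: "1 \<le> \<rho>" and x: "x \<in> cball (axis k (4 * \<rho>)) \<rho>" and ab: "0 \<le> a" "0 \<le> b"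
  shows "x \<in> half_space k" "2 * \<rho> \<le> (x - axis k 1) $ k" "2 * \<rho> \<le> norm (x - axis k 1)"
    "2 powr a * 6 powr (- b) * \<rho> powr (a - b) \<le> half_power k a b (x - axis k 1)"
proof -
  define y where "y = x - axis k 1"
  have "\<bar>(axis k (4 * \<rho>) - x) $ k\<bar> \<le> \<rho>"
    using x component_le_norm_cart[of "axis k (4 * \<rho>) - x" k] by (simp add: dist_norm)
  then have "3 * \<rho> \<le> x $ k" by simp
  then show "x \<in> half_space k" and yk: "2 * \<rho> \<le> (x - axis k 1) $ k"
    using \<rho> by (auto simp: half_space_def)
  then show n: "2 * \<rho> \<le> norm (x - axis k 1)"
    using component_le_norm_cart[of "x - axis k 1" k] by linarith
  have "norm x \<le> dist x (axis k (4 * \<rho>)) + norm (axis k (4 * \<rho>) :: real^'n)"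
    using dist_triangle[of x 0 "axis k (4 * \<rho>)"] by simp
  moreover have "norm (axis k (4 * \<rho>) :: real^'n) = 4 * \<rho>"
  proof -
    have "axis k (4 * \<rho>) = (4 * \<rho>) *\<^sub>R (axis k 1 :: real^'n)" by (simp add: vec_eq_iff axis_def)
    then show ?thesis using \<rho> by simp
  qed
  ultimately have "norm x \<le> 5 * \<rho>" using x by (simp add: dist_commute)
  then have "norm y \<le> 6 * \<rho>"
    using norm_triangle_ineq4[of x "axis k 1"] \<rho> by (simp add: y_def)
  moreover have "norm y > 0" using n \<rho> unfolding y_def by linarith
  ultimately have "(6 * \<rho>) powr (- b) \<le> norm y powr (- b)"
    using ab by (intro powr_mono2') auto
  moreover have "(2 * \<rho>) powr a \<le> (y $ k) powr a"
    using yk \<rho> ab by (intro powr_mono2) (auto simp: y_def)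
  ultimately have "(2 * \<rho>) powr a * (6 * \<rho>) powr (- b) \<le> half_power k a b y"
    unfolding half_power_def by (intro mult_mono) auto
  moreover have "(2 * \<rho>) powr a * (6 * \<rho>) powr (- b) = 2 powr a * 6 powr (- b) * \<rho> powr (a - b)"
    using \<rho> by (simp add: powr_mult powr_diff powr_minus divide_simps)
  ultimately show "2 powr a * 6 powr (- b) * \<rho> powr (a - b) \<le> half_power k a b (x - axis k 1)"
    by (simp add: y_def)
qed

section \<open>Nonexistence of positive pairs\<close>

lemma no_positive_supersolution_product_one:
  fixes u v :: "real^'n \<Rightarrow> real"
  assumes lL: "0 < l" "l \<le> L" and p: "0 < p" and q: "0 < q"
    and sol: "nonneg_supersolution l L p q k u v"
    and pos: "\<And>x. x \<in> half_space k \<Longrightarrow> 0 < u x" "\<And>x. x \<in> half_space k \<Longrightarrow> 0 < v x"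
  shows "p * q \<noteq> 1"
proof
  assume pq: "p * q = 1"
  obtain C where C: "C > 0"
    "\<And>\<rho>. 0 < \<rho> \<Longrightarrow> \<exists>x\<in>cball (axis k (4 * \<rho>)) \<rho>. u x powr (p * q - 1) \<le> (C / \<rho>\<^sup>2) powr (p + 1)"
    using system_decay[OF lL p q sol pos] by blast
  define \<rho> where "\<rho> = max 1 (2 * C)"
  have \<rho>: "\<rho> \<ge> 1" "2 * C \<le> \<rho>" by (auto simp: \<rho>_def)
  then have "\<rho> \<le> \<rho>\<^sup>2" using mult_left_mono[of 1 \<rho> \<rho>] by (simp add: power2_eq_square)
  then have D: "C / \<rho>\<^sup>2 < 1" "C / \<rho>\<^sup>2 > 0" using \<rho> C(1) by (auto simp: divide_less_eq)
  obtain x where x: "x \<in> cball (axis k (4 * \<rho>)) \<rho>" "u x powr (p * q - 1) \<le> (C / \<rho>\<^sup>2) powr (p + 1)"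
    using C(2)[of \<rho>] \<rho> by auto
  \<comment> \<open>Positivity matters: \<open>u x powr 0\<close> is \<open>1\<close> only for a
    nonzero base.\<close>
  have "u x > 0" using half_power_on_cball(1)[OF \<rho>(1) x(1), of 0 0] pos by auto
  then have "1 \<le> (C / \<rho>\<^sup>2) powr (p + 1)" using x(2) pq by simp
  moreover have "(C / \<rho>\<^sup>2) powr (p + 1) < 1" using powr_less_mono2[of "p + 1" "C / \<rho>\<^sup>2" 1] D p by simp
  ultimately show False by simp
qed

text \<open>Lower bound and decay together keep a power of \<open>\<rho>\<close> bounded for all
  \<open>\<rho> \<ge> 1\<close>, which is absurd for a positive exponent. Exchanging the two
  components covers the alternative with \<open>q\<close>.\<close>

lemma no_positive_supersolution_subcritical:
  fixes u v :: "real^'n \<Rightarrow> real"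
  assumes n: "CARD('n) \<ge> 2" and lL: "0 < l" "l \<le> L" and p: "0 < p" and q: "0 < q" and pq: "p * q > 1"
    and sol: "nonneg_supersolution l L p q k u v"
    and pos: "\<And>x. x \<in> half_space k \<Longrightarrow> 0 < u x" "\<And>x. x \<in> half_space k \<Longrightarrow> 0 < v x"
  shows "2 * (p + 1) / (p * q - 1) \<le> L * real CARD('n) / l - 1"
proof (rule ccontr)
  define al where "al = L * real CARD('n) / l - 1"
  assume "\<not> ?thesis"
  then have "al < 2 * (p + 1) / (p * q - 1)" unfolding al_def by (rule not_le_imp_less)
  then have al: "2 * (p + 1) - al * (p * q - 1) > 0" (is "?e > 0")
    using pq by (simp add: less_divide_eq)
  define a where "a = L / l"
  define b where "b = L / l * (real CARD('n) + 1) - 1"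
  have a: "a \<ge> 1" using lL by (simp add: a_def)
  have ab: "a - b = - al" by (simp add: a_def b_def al_def algebra_simps)
  have b: "b \<ge> 0"
    using mult_mono[of 1 a 1 "real CARD('n) + 1"] a unfolding b_def a_def[symmetric] by simp
  have sol': "continuous_on (half_space k) u" "visc_supersol l L (half_space k) u (\<lambda>x. v x powr p)"
    using sol by (auto simp: nonneg_supersolution_def)
  obtain C where C: "C > 0"
    "\<And>\<rho>. 0 < \<rho> \<Longrightarrow> \<exists>x\<in>cball (axis k (4 * \<rho>)) \<rho>. u x powr (p * q - 1) \<le> (C / \<rho>\<^sup>2) powr (p + 1)"
    using system_decay[OF lL p q sol pos] by blast
  have vp: "0 < v x powr p" if "x \<in> half_space k" for x using pos(2)[OF that] by simp
  obtain c where c: "c > 0" "\<And>y. 0 \<le> y $ k \<Longrightarrow> 1 \<le> norm y \<Longrightarrow> c * half_power k a b y \<le> u (y + axis k 1)"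
    using half_power_lower_bound[OF n lL sol'(2,1) pos(1) vp] unfolding a_def b_def by blast
  define c' where "c' = c * (2 powr a * 6 powr (- b))"
  have c': "c' > 0" using c(1) by (simp add: c'_def)
  define M where "M = C powr (p + 1) / c' powr (p * q - 1)"
  have bound: "\<rho> powr ?e \<le> M" if \<rho>: "1 \<le> \<rho>" for \<rho>
  proof -
    obtain x where x: "x \<in> cball (axis k (4 * \<rho>)) \<rho>" "u x powr (p * q - 1) \<le> (C / \<rho>\<^sup>2) powr (p + 1)"
      using C(2)[of \<rho>] \<rho> by auto
    note hx = half_power_on_cball[OF \<rho> x(1) order_trans[OF zero_le_one a] b]
    have "c' * \<rho> powr (- al) \<le> c * half_power k a b (x - axis k 1)"
      using mult_left_mono[OF hx(4), of c] c(1) by (simp add: c'_def ab mult.assoc)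
    also have "\<dots> \<le> u x" using c(2)[of "x - axis k 1"] hx(2,3) \<rho> by simp
    finally have "(c' * \<rho> powr (- al)) powr (p * q - 1) \<le> u x powr (p * q - 1)"
      using c' pq by (intro powr_mono2) auto
    also note x(2)
    finally have "c' powr (p * q - 1) * \<rho> powr (- al * (p * q - 1)) \<le> C powr (p + 1) * \<rho> powr (- (2 * (p + 1)))"
      using c' C(1) \<rho> by (simp add: powr_mult powr_powr powr_divide_sq)
    then have "c' powr (p * q - 1) * \<rho> powr (- al * (p * q - 1)) * \<rho> powr (2 * (p + 1))
        \<le> C powr (p + 1) * \<rho> powr (- (2 * (p + 1))) * \<rho> powr (2 * (p + 1))"
      by (rule mult_right_mono) simp
    moreover have "\<rho> powr (- al * (p * q - 1)) * \<rho> powr (2 * (p + 1)) = \<rho> powr ?e"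
      by (simp add: powr_add[symmetric] algebra_simps)
    moreover have "\<rho> powr (- (2 * (p + 1))) * \<rho> powr (2 * (p + 1)) = 1"
      using \<rho> by (simp add: powr_add[symmetric])
    ultimately have "c' powr (p * q - 1) * \<rho> powr ?e \<le> C powr (p + 1)" by (simp add: mult.assoc)
    then show ?thesis using c' by (simp add: M_def le_divide_eq mult.commute)
  qed
  have M: "M > 0" using c' C(1) by (simp add: M_def)
  define \<rho> where "\<rho> = (M + 1) powr (1 / ?e)"
  have "\<rho> \<ge> 1" using M al by (simp add: \<rho>_def ge_one_powr_ge_zero)
  moreover have "\<rho> powr ?e = M + 1" using M al by (simp add: \<rho>_def powr_powr)
  ultimately show False using bound[of \<rho>] by simp
qed

text \<open>Two rounds: the power bound for \<open>v\<close> becomes a bound for the source in the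
  equation for \<open>u\<close>, which yields the logarithm. The powers of \<open>\<rho>\<close>
  then cancel and \<open>ln \<rho>\<close> would stay bounded.\<close>

lemma no_positive_supersolution_critical:
  fixes u v :: "real^'n \<Rightarrow> real"
  assumes n: "CARD('n) \<ge> 2" and lL: "0 < l" "l \<le> L" and p: "0 < p" and pp: "p * p > 1"
    and crit: "2 * (p + 1) / (p * p - 1) = L * real CARD('n) / l - 1"
    and sol: "nonneg_supersolution l L p p k u v"
    and pos: "\<And>x. x \<in> half_space k \<Longrightarrow> 0 < u x" "\<And>x. x \<in> half_space k \<Longrightarrow> 0 < v x"
  shows False
proof -
  define al where "al = L * real CARD('n) / l - 1"
  have al: "al * (p * p - 1) = 2 * (p + 1)" using crit pp by (simp add: al_def[symmetric] divide_eq_eq)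
  \<comment> \<open>The factor \<open>p + 1\<close> cancels in the critical relation and leaves the
    degree condition of the logarithmic bound.\<close>
  have alp: "al * p = al + 2"
  proof -
    have "(al * (p - 1) - 2) * (p + 1) = 0" using al by (simp add: algebra_simps)
    then have "al * (p - 1) - 2 = 0" using p by simp
    then show ?thesis by (simp add: algebra_simps)
  qed
  define a where "a = L / l"
  define b where "b = L / l * (real CARD('n) + 1) - 1"
  have a: "a \<ge> 1" using lL by (simp add: a_def)
  have ab: "a - b = - al" "b - a = al" by (simp_all add: a_def b_def al_def algebra_simps)
  have b: "b \<ge> 0"
    using mult_mono[of 1 a 1 "real CARD('n) + 1"] a unfolding b_def a_def[symmetric] by simp
  have sol': "continuous_on (half_space k) u" "continuous_on (half_space k) v"
    "visc_supersol l L (half_space k) u (\<lambda>x. v x powr p)" "visc_supersol l L (half_space k) v (\<lambda>x. u x powr p)"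
    using sol by (auto simp: nonneg_supersolution_def)
  obtain C where C: "C > 0"
    "\<And>\<rho>. 0 < \<rho> \<Longrightarrow> \<exists>x\<in>cball (axis k (4 * \<rho>)) \<rho>. u x powr (p * p - 1) \<le> (C / \<rho>\<^sup>2) powr (p + 1)"
    using system_decay[OF lL p p sol pos] by blast
  have up: "0 < u x powr p" and vp: "0 < v x powr p" if "x \<in> half_space k" for x
    using pos[OF that] by simp_all
  obtain cv where cv: "cv > 0" "\<And>y. 0 \<le> y $ k \<Longrightarrow> 1 \<le> norm y \<Longrightarrow> cv * half_power k a b y \<le> v (y + axis k 1)"
    using half_power_lower_bound[OF n lL sol'(4,2) pos(2) up] unfolding a_def b_def by blast
  have "(cv * half_power k a b y) powr p \<le> v (y + axis k 1) powr p" if "0 \<le> y $ k" "1 \<le> norm y" for y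
    using cv(2)[OF that] cv(1) p half_power_nonneg[of k a b y] by (intro powr_mono2) auto
  then obtain c where c: "c > 0" "\<And>y. 0 \<le> y $ k \<Longrightarrow> 1 \<le> norm y \<Longrightarrow>
      c * (half_power k a b y * ln (norm y)) \<le> u (y + axis k 1)"
    using half_power_log_lower_bound[OF n lL sol'(3,1) pos(1) vp a_def b_def _ p cv(1)] alp ab by auto
  define c' where "c' = c * (2 powr a * 6 powr (- b))"
  have c': "c' > 0" using c(1) by (simp add: c'_def)
  have bound: "(c' * ln \<rho>) powr (p * p - 1) \<le> C powr (p + 1)" if \<rho>: "1 \<le> \<rho>" for \<rho>
  proof -
    obtain x where x: "x \<in> cball (axis k (4 * \<rho>)) \<rho>" "u x powr (p * p - 1) \<le> (C / \<rho>\<^sup>2) powr (p + 1)"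
      using C(2)[of \<rho>] \<rho> by auto
    note hx = half_power_on_cball[OF \<rho> x(1) order_trans[OF zero_le_one a] b]
    have "ln \<rho> \<le> ln (norm (x - axis k 1))"
      by (rule ln_le_cancel_iff[THEN iffD2]) (use hx(3) \<rho> in linarith)+
    then have "(2 powr a * 6 powr (- b) * \<rho> powr (a - b)) * ln \<rho>
        \<le> half_power k a b (x - axis k 1) * ln (norm (x - axis k 1))"
      using hx(4) \<rho> by (intro mult_mono half_power_nonneg) auto
    from mult_left_mono[OF this, of c]
    have "c' * ln \<rho> * \<rho> powr (- al) \<le> c * (half_power k a b (x - axis k 1) * ln (norm (x - axis k 1)))"
      using c(1) by (simp add: c'_def ab mult_ac)
    also have "\<dots> \<le> u x" using c(2)[of "x - axis k 1"] hx(2,3) \<rho> by simp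
    finally have "(c' * ln \<rho> * \<rho> powr (- al)) powr (p * p - 1) \<le> u x powr (p * p - 1)"
      using c' pp \<rho> by (intro powr_mono2) auto
    also note x(2)
    finally have "(c' * ln \<rho>) powr (p * p - 1) * \<rho> powr (- al * (p * p - 1)) \<le> C powr (p + 1) * \<rho> powr (- (2 * (p + 1)))"
      using c' C(1) \<rho> by (simp add: powr_mult powr_powr powr_divide_sq)
    moreover have "- al * (p * p - 1) = - (2 * (p + 1))" using al by simp
    ultimately show ?thesis using \<rho> by simp
  qed
  define M where "M = C powr (p + 1)"
  have M: "M > 0" using C(1) by (simp add: M_def)
  define \<rho> where "\<rho> = exp ((M + 1) powr (1 / (p * p - 1)) / c')"
  have "\<rho> \<ge> 1" using c' by (simp add: \<rho>_def)
  moreover have "(c' * ln \<rho>) powr (p * p - 1) = M + 1" using c' M pp by (simp add: \<rho>_def powr_powr)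
  ultimately show False using bound[of \<rho>] by (simp add: M_def)
qed

section \<open>Dichotomy between trivial and positive pairs\<close>

lemma nonneg_supersolution_swap:
  "nonneg_supersolution l L p q k u v \<Longrightarrow> nonneg_supersolution l L q p k v u"
  by (auto simp: nonneg_supersolution_def)

text \<open>A zero of \<open>u\<close> is a minimum, so the constant \<open>0\<close> is a test
  function there.\<close>

lemma visc_supersol_zero_imp:
  assumes "visc_supersol l L S u f" "0 \<le> l" "l \<le> L" "\<And>x. x \<in> S \<Longrightarrow> 0 \<le> u x" "x \<in> S" "u x = 0"
  shows "f x \<le> 0"
proof -
  have "local_min_on S (\<lambda>x. u x - 0) x"
    using assms(4-6) by (auto simp: local_min_on_def intro: exI[of _ 1])
  from visc_supersol_twice_diff[OF assms(1-3) this twice_diff_const, of 0]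
  show ?thesis by (simp add: pucci_ge_def)
qed

text \<open>A zero of one component is a zero of the other by the equations, and a single zero makes
  a component vanish throughout by the strong minimum principle.\<close>

lemma supersolution_trivial_or_positive:
  assumes lL: "0 < l" "l \<le> L" and sol: "nonneg_supersolution l L p q k u v"
  shows "(\<forall>x\<in>half_space k. u x = 0 \<and> v x = 0) \<or> (\<forall>x\<in>half_space k. 0 < u x \<and> 0 < v x)"
proof -
  let ?S = "half_space k"
  have s: "continuous_on ?S u" "continuous_on ?S v" "\<And>x. x \<in> ?S \<Longrightarrow> 0 \<le> u x" "\<And>x. x \<in> ?S \<Longrightarrow> 0 \<le> v x"
    "visc_supersol l L ?S u (\<lambda>x. v x powr p)" "visc_supersol l L ?S v (\<lambda>x. u x powr q)"
    using sol by (auto simp: nonneg_supersolution_def)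
  have zero: "x = 0" if "x powr r \<le> 0" for x r :: real
    using that powr_ge_zero[of x r] by (metis order_antisym powr_eq_0_iff)
  have uv: "v x = 0" if "x \<in> ?S" "u x = 0" for x
    using visc_supersol_zero_imp[OF s(5) _ lL(2) s(3) that] lL(1) by (intro zero[of _ p]) simp
  have vu: "u x = 0" if "x \<in> ?S" "v x = 0" for x
    using visc_supersol_zero_imp[OF s(6) _ lL(2) s(4) that] lL(1) by (intro zero[of _ q]) simp
  have "0 < u y" if "x \<in> ?S" "u x \<noteq> 0" "y \<in> ?S" for x y
    by (rule strong_minimum_principle[OF s(5) lL _ s(1,3) open_half_space connected_half_space that]) auto
  moreover have "0 < v y" if "x \<in> ?S" "v x \<noteq> 0" "y \<in> ?S" for x y
    by (rule strong_minimum_principle[OF s(6) lL _ s(2,4) open_half_space connected_half_space that]) auto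
  ultimately show ?thesis using uv vu by blast
qed

section \<open>The zero pair as a supersolution\<close>

text \<open>The Hessian \<open>D2\<phi>\<close> of a test function is not given as symmetric, so its
  real eigenvalues are treated one by one instead of through a frame.\<close>

lemma charpoly_root_eigenvector:
  fixes M :: "real^'n^'n"
  assumes "poly (charpoly M) e = 0"
  obtains w where "w \<noteq> 0" "M *v w = e *\<^sub>R w"
proof -
  define A :: "real^'n^'n" where "A = (\<chi> i j. (if i = j then e else 0) - M $ i $ j)"
  have "det A = poly (charpoly M) e"
    unfolding charpoly_def det_def poly_sum poly_mult poly_prod
    by (intro sum.cong prod.cong arg_cong2[where f = "(*)"]) (auto simp: A_def)
  then have "\<not> invertible A" using assms by (simp add: invertible_det_nz)
  then obtain w where w: "A *v w = 0" "w \<noteq> 0"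
    unfolding invertible_left_inverse matrix_left_invertible_ker by blast
  have "A = e *\<^sub>R mat 1 - M" by (simp add: A_def vec_eq_iff mat_def)
  then have "A *v w = e *\<^sub>R w - M *v w"
    by (simp add: matrix_vector_mult_diff_rdistrib flip: scaleR_matrix_vector_assoc)
  then show thesis using that[of w] w by simp
qed

text \<open>A test function touching zero from below has a local maximum, so its Hessian form is
  nonpositive, and with it every real eigenvalue.\<close>

lemma visc_supersol_zero:
  fixes S :: "(real^'n) set"
  assumes S: "open S" and L: "0 \<le> L" and u: "\<And>x. x \<in> S \<Longrightarrow> u x = 0" and f: "\<And>x. x \<in> S \<Longrightarrow> f x \<le> 0"
  shows "visc_supersol l L S u f"
  unfolding visc_supersol_def
proof (intro allI impI)
  fix \<phi> D\<phi> D2\<phi> x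
  assume C2: "C2_on S \<phi> D\<phi> D2\<phi>" and min: "local_min_on S (\<lambda>x. u x - \<phi> x) x"
  then obtain r where r: "r > 0" "\<And>y. y \<in> S \<Longrightarrow> dist y x < r \<Longrightarrow> u x - \<phi> x \<le> u y - \<phi> y" and x: "x \<in> S"
    by (auto simp: local_min_on_def)
  obtain r' where r': "r' > 0" "ball x r' \<subseteq> S" using S x by (auto simp: open_contains_ball)
  have max: "\<phi> y \<le> \<phi> x" if "dist y x < min r r'" for y
  proof -
    have "y \<in> S" using that r'(2) by (auto simp: dist_commute subset_iff)
    then show ?thesis using r(2)[of y] that u x by simp
  qed
  have "\<forall>\<^sub>F y in nhds x. (\<phi> has_derivative (\<lambda>h. D\<phi> y \<bullet> h)) (at y)"
    using eventually_nhds_in_open[OF S x] C2 by (auto simp: C2_on_def elim: eventually_mono)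
  note peano = peano_expansion[OF this, of "\<lambda>h. D2\<phi> x *v h"]
  have nonpos: "w \<bullet> (D2\<phi> x *v w) \<le> 0" for w
  proof (rule field_le_epsilon)
    fix e :: real assume e: "e > 0"
    define W where "W = (norm w)\<^sup>2 + 1"
    define \<epsilon> where "\<epsilon> = e / (2 * W)"
    have \<epsilon>: "\<epsilon> > 0" "2 * \<epsilon> * (norm w)\<^sup>2 \<le> e"
    proof -
      have W: "W > 0" by (simp add: W_def add_nonneg_pos)
      then show "\<epsilon> > 0" using e by (simp add: \<epsilon>_def)
      have "2 * \<epsilon> * (norm w)\<^sup>2 \<le> 2 * \<epsilon> * W" using \<open>\<epsilon> > 0\<close> by (simp add: W_def)
      also have "\<dots> = e" using W by (simp add: \<epsilon>_def)
      finally show "2 * \<epsilon> * (norm w)\<^sup>2 \<le> e" .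
    qed
    obtain s where s: "s > 0" "\<And>h. norm h < s \<Longrightarrow>
        \<bar>\<phi> (x + h) - \<phi> x - D\<phi> x \<bullet> h - (h \<bullet> (D2\<phi> x *v h)) / 2\<bar> \<le> \<epsilon> * (norm h)\<^sup>2"
      using peano[OF _ \<epsilon>(1)] C2 x by (auto simp: C2_on_def)
    define V where "V = norm w + 1"
    have V: "V > 0" by (simp add: V_def add_nonneg_pos)
    define t where "t = min s (min r r') / (2 * V)"
    have t: "t > 0" using s r r' V by (simp add: t_def)
    have "t * norm w < min s (min r r')"
    proof -
      have "t * norm w \<le> t * V" using t by (simp add: V_def)
      also have "\<dots> = min s (min r r') / 2" using V by (simp add: t_def)
      also have "\<dots> < min s (min r r')" using s(1) r(1) r'(1) by (simp add: min_def)
      finally show ?thesis .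
    qed
    then have tw: "norm (t *\<^sub>R w) < s" "norm (t *\<^sub>R w) < min r r'" using t by auto
    define Q where "Q = t\<^sup>2 * (w \<bullet> (D2\<phi> x *v w))"
    \<comment> \<open>Maximality is used at \<open>x + t w\<close> and at \<open>x - t w\<close>; in
      the sum the gradient terms cancel.\<close>
    have "Q / 2 + D\<phi> x \<bullet> (t *\<^sub>R w) \<le> \<epsilon> * (norm (t *\<^sub>R w))\<^sup>2"
      using s(2)[OF tw(1)] max[of "x + t *\<^sub>R w"] tw(2)
      by (simp add: Q_def dist_norm matrix_vector_mult_scaleR power2_eq_square abs_le_iff)
    moreover have "Q / 2 - D\<phi> x \<bullet> (t *\<^sub>R w) \<le> \<epsilon> * (norm (t *\<^sub>R w))\<^sup>2"
    proof -
      have "- (t *\<^sub>R w) \<bullet> (D2\<phi> x *v - (t *\<^sub>R w)) = Q"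
        by (simp add: Q_def matrix_vector_mult_scaleR power2_eq_square flip: scaleR_minus_left)
      then show ?thesis
        using s(2)[of "- (t *\<^sub>R w)"] max[of "x + - (t *\<^sub>R w)"] tw
        by (simp only: norm_minus_cancel) (simp add: dist_norm abs_le_iff)
    qed
    ultimately have "Q \<le> 2 * \<epsilon> * (norm (t *\<^sub>R w))\<^sup>2" by simp
    also have "\<dots> = t\<^sup>2 * (2 * \<epsilon> * (norm w)\<^sup>2)" by (simp add: power_mult_distrib)
    also have "\<dots> \<le> t\<^sup>2 * e" using \<epsilon>(2) by (intro mult_left_mono) auto
    finally show "w \<bullet> (D2\<phi> x *v w) \<le> 0 + e" using t by (simp add: Q_def)
  qed
  have "e \<le> 0" if "e \<in># eigenvalues (D2\<phi> x)" for e
  proof -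
    \<comment> \<open>\<open>proots\<close> of the zero polynomial is empty, so a member of the
      multiset rules that polynomial out.\<close>
    have "charpoly (D2\<phi> x) \<noteq> 0" using that by (auto simp: eigenvalues_def)
    then have "poly (charpoly (D2\<phi> x)) e = 0" using that by (auto simp: eigenvalues_def)
    then obtain w where w: "w \<noteq> 0" "D2\<phi> x *v w = e *\<^sub>R w"
      using charpoly_root_eigenvector by blast
    moreover have "w \<bullet> w > 0" using w(1) by simp
    moreover have "e * (w \<bullet> w) \<le> 0" using nonpos[of w] w(2) by simp
    ultimately show ?thesis by (meson mult_le_0_iff not_le)
  qed
  then have none: "{#e \<in># eigenvalues (D2\<phi> x). e > 0#} = {#}" by (auto simp: filter_mset_eq_mempty_iff not_less)
  moreover have "sum_mset {#e \<in># eigenvalues (D2\<phi> x). e < 0#} \<le> 0"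
  proof -
    have "(\<forall>e\<in>#A. e \<le> 0) \<Longrightarrow> sum_mset A \<le> 0" for A :: "real multiset"
      by (induction A) (auto simp: add_nonpos_nonpos)
    then show ?thesis by auto
  qed
  ultimately show "pucci_minus l L (D2\<phi> x) + f x \<le> 0"
    using f[OF x] L unfolding pucci_minus_def none by (simp add: mult_nonneg_nonpos add_nonpos_nonpos)
qed

theorem corollary2:
  fixes l L p q :: real and k :: "'n::finite" and u v :: "real^'n \<Rightarrow> real"
  assumes "CARD('n) \<ge> 2"
    and "0 < l" and "l \<le> L"
    and "p > 0" and "q > 0"
    and "(p * q > 1 \<and>
           (2 * (p + 1) / (p * q - 1) > L * real CARD('n) / l - 1 \<or>
            2 * (q + 1) / (p * q - 1) > L * real CARD('n) / l - 1)) \<or>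
         (2 * (p + 1) / (p * q - 1) = L * real CARD('n) / l - 1 \<and>
          2 * (q + 1) / (p * q - 1) = L * real CARD('n) / l - 1) \<or>
         p * q = 1"
  shows "nonneg_supersolution l L p q k u v \<longleftrightarrow> (\<forall>x\<in>half_space k. u x = 0 \<and> v x = 0)"
proof
  assume "\<forall>x\<in>half_space k. u x = 0 \<and> v x = 0"
  then have zero: "\<And>x. x \<in> half_space k \<Longrightarrow> u x = 0" "\<And>x. x \<in> half_space k \<Longrightarrow> v x = 0" by auto
  then have "continuous_on (half_space k) u" "continuous_on (half_space k) v"
    by (simp_all cong: continuous_on_cong)
  moreover have "visc_supersol l L (half_space k) u (\<lambda>x. v x powr p)"
    "visc_supersol l L (half_space k) v (\<lambda>x. u x powr q)"
    using assms(2,3) zero by (intro visc_supersol_zero[OF open_half_space]; simp)+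
  ultimately show "nonneg_supersolution l L p q k u v"
    using zero by (simp add: nonneg_supersolution_def)
next
  assume sol: "nonneg_supersolution l L p q k u v"
  note lL = assms(2,3) and pq = assms(4,5)
  show "\<forall>x\<in>half_space k. u x = 0 \<and> v x = 0"
  proof (rule ccontr)
    assume "\<not> ?thesis"
    then have pos: "\<And>x. x \<in> half_space k \<Longrightarrow> 0 < u x" "\<And>x. x \<in> half_space k \<Longrightarrow> 0 < v x"
      using supersolution_trivial_or_positive[OF lL sol] by auto
    define \<alpha> where "\<alpha> = L * real CARD('n) / l - 1"
    have "p * q \<noteq> 1"
      by (rule no_positive_supersolution_product_one[OF lL pq sol pos])
    have sub: "2 * (p + 1) / (p * q - 1) \<le> \<alpha>" "2 * (q + 1) / (p * q - 1) \<le> \<alpha>" if "p * q > 1"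
      using no_positive_supersolution_subcritical[OF assms(1) lL pq that sol pos]
        no_positive_supersolution_subcritical[OF assms(1) lL pq(2,1) _ nonneg_supersolution_swap[OF sol] pos(2,1)] that
      by (simp_all add: \<alpha>_def mult.commute[of q p])
    \<comment> \<open>A strict inequality as in case (1) contradicts \<open>sub\<close>, so only the
      two equalities of case (2) remain.\<close>
    from assms(6) \<open>p * q \<noteq> 1\<close> sub
    have crit: "2 * (p + 1) / (p * q - 1) = \<alpha>" "2 * (q + 1) / (p * q - 1) = \<alpha>"
      unfolding \<alpha>_def[symmetric] by force+
    have "\<alpha> > 0"
    proof -
      have "l * 2 \<le> L * real CARD('n)" using lL assms(1) by (intro mult_mono) auto
      then have "2 \<le> L * real CARD('n) / l" using lL(1) by (simp add: pos_le_divide_eq mult.commute)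
      then show ?thesis by (simp add: \<alpha>_def)
    qed
    \<comment> \<open>Case (2) does not state the sign of \<open>p q - 1\<close>. It follows because
      the quotient equals \<open>\<alpha> > 0\<close> and has a positive numerator; a zero
      denominator would give the value \<open>0\<close>.\<close>
    then have pq1: "p * q > 1" using crit(1) pq(1) by (simp add: zero_less_divide_iff flip: crit(1))
    then have "p = q" using crit by (simp add: divide_eq_eq)
    then show False
      using no_positive_supersolution_critical[OF assms(1) lL pq(1)] pq1 crit(1) sol pos
      unfolding \<alpha>_def by blast
  qed
qed

end
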